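(* Let $n,m\ge1$, and let $X=X(n,m)$ be the competition complexity of $n$ bidders with valuations that are additive over $m$ independent, regular items. Let $([m],\mathcal I)$ be a matroid with disjoint spanning number $\rho$. Then the competition complexity of $n$ bidders with valuations that are additive subject to the constraints $\mathcal I$ over $m$ independent, regular items is at most $X+\rho$.
   Context: Disjoint spanning number: let $([m],\mathcal I)$ be a matroid with rank function $r$. A set $S\subseteq[m]$ spans an element $j\in[m]\setminus S$ if $r(S\cup\{j\})=r(S)$. A disjoint spanning collection of $j$ is a family $\mathcal I'\subseteq\mathcal I$ of pairwise disjoint independent sets, none containing $j$, each of which spans $j$. Let $\rho_j$ be the maximum of $|\mathcal I'|$ over all disjoint spanning collections of $j$; the disjoint spanning number is $\rho=\max_j\rho_j$. A one-dimensional distribution $F_j$ on $[0,\infty)$ (identified with its CDF) is taken to be continuous, with density $f_j$ positive on an interval; its virtual value function is $\varphi_j(x)=x-\frac{1-F_j(x)}{f_j(x)}$, and $F_j$ is regular if $\varphi_j$ is non-decreasing. A distribution $F$ over valuations is additive subject to $\mathcal I$ over $m$ independent, regular items if there are regular $F_1,\dots,F_m$ such that $v\sim F$ is obtained by drawing $v_j\sim F_j$ independently and setting $v(S)=\max_{T\subseteq S,\,T\in\mathcal I}\sum_{j\in T}v_j$ for $S\subseteq[m]$; it is additive over $m$ independent, regular items if $\mathcal I=2^{[m]}$. Bidders' valuations are i.i.d. from $F$; utilities are quasi-linear. A (possibly randomized) mechanism maps bids to an allocation of the items (each item to at most one bidder) and payments. It is BIC if truth-telling maximizes each bidder's expected utility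 given that the others report truthfully, and BIR if each bidder's expected utility from truthful reporting is non-negative (expectations over the mechanism's randomness and the others' valuations). $\mathrm{OPT}(F,n)$ is the optimal (supremum) expected revenue over all BIC and BIR mechanisms for $n$ bidders with valuations i.i.d. from $F$. $\mathrm{Rev}(M,F,k)$ is the expected revenue of mechanism $M$ with $k$ bidders with valuations i.i.d. from $F$. VCG chooses a welfare-maximizing allocation and charges each bidder her externality (maximum welfare of the others without her, minus the welfare of the others in the chosen allocation). The competition complexity of $n$ bidders for a class $\mathcal D$ of distributions is the least integer $c\ge0$ such that $\mathrm{OPT}(F,n)\le\mathrm{Rev}(\mathrm{VCG},F,n+c)$ for all $F\in\mathcal D$. *)

theory Defs
  imports "HOL-Probability.Probability"
begin

text \<open>
  Items are the elements of \<open>{..<m}\<close> and bidders the elements of \<open>{..<n}\<close>.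
\<close>

subsection \<open>Matroids and the disjoint spanning number\<close>

definition matroid :: "'a set \<Rightarrow> 'a set set \<Rightarrow> bool" where
  "matroid E \<I> \<longleftrightarrow>
     finite E \<and> \<I> \<subseteq> Pow E \<and> {} \<in> \<I> \<and>
     (\<forall>B\<in>\<I>. \<forall>A. A \<subseteq> B \<longrightarrow> A \<in> \<I>) \<and>
     (\<forall>A\<in>\<I>. \<forall>B\<in>\<I>. card A < card B \<longrightarrow> (\<exists>x\<in>B - A. insert x A \<in> \<I>))"

definition matroid_rank :: "'a set set \<Rightarrow> 'a set \<Rightarrow> nat" where
  "matroid_rank \<I> S = Max (card ` {T \<in> \<I>. T \<subseteq> S})"

definition spans :: "'a set set \<Rightarrow> 'a set \<Rightarrow> 'a \<Rightarrow> bool" where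
  "spans \<I> S j \<longleftrightarrow> j \<notin> S \<and> matroid_rank \<I> (insert j S) = matroid_rank \<I> S"

definition disjoint_spanning_collection :: "'a set set \<Rightarrow> 'a \<Rightarrow> 'a set set \<Rightarrow> bool" where
  "disjoint_spanning_collection \<I> j \<C> \<longleftrightarrow>
     \<C> \<subseteq> \<I> \<and> disjoint \<C> \<and> (\<forall>S\<in>\<C>. j \<notin> S \<and> spans \<I> S j)"

definition disjoint_spanning_number_at :: "'a set set \<Rightarrow> 'a \<Rightarrow> nat" where
  "disjoint_spanning_number_at \<I> j = Max (card ` {\<C>. disjoint_spanning_collection \<I> j \<C>})"

definition disjoint_spanning_number :: "'a set \<Rightarrow> 'a set set \<Rightarrow> nat" where
  "disjoint_spanning_number E \<I> = Max (disjoint_spanning_number_at \<I> ` E)"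

subsection \<open>Regular one-dimensional distributions\<close>

definition virtual_value :: "real measure \<Rightarrow> (real \<Rightarrow> real) \<Rightarrow> real \<Rightarrow> real" where
  "virtual_value D f x = x - (1 - cdf D x) / f x"

text \<open>
  The virtual value is meaningful only where the density is positive, so monotonicity is
  required on the interval \<open>T\<close>, which may be open, closed, half-open or unbounded.
\<close>

definition regular_distribution :: "real measure \<Rightarrow> bool" where
  "regular_distribution D \<longleftrightarrow>
     real_distribution D \<and>
     (\<exists>f T. f \<in> borel_measurable borel \<and> is_interval T \<and> T \<subseteq> {0..} \<and>
        (\<forall>x\<in>T. 0 < f x) \<and> (\<forall>x. x \<notin> T \<longrightarrow> f x = 0) \<and>
        D = density lborel (\<lambda>x. ennreal (f x)) \<and>
        mono_on T (virtual_value D f))"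

subsection \<open>Valuations\<close>

type_synonym valuation = "nat set \<Rightarrow> real"
type_synonym bids = "nat \<Rightarrow> valuation"

definition valuation_space :: "nat \<Rightarrow> valuation measure" where
  "valuation_space m = PiM (Pow {..<m}) (\<lambda>_. borel)"

definition constrained_valuation :: "nat \<Rightarrow> nat set set \<Rightarrow> (nat \<Rightarrow> real) \<Rightarrow> valuation" where
  "constrained_valuation m \<I> x =
     (\<lambda>S\<in>Pow {..<m}. Max ((\<lambda>T. \<Sum>j\<in>T. x j) ` {T \<in> \<I>. T \<subseteq> S}))"

definition additive_subject_to :: "nat \<Rightarrow> nat set set \<Rightarrow> valuation measure set" where
  "additive_subject_to m \<I> =
     {distr (PiM {..<m} D) (valuation_space m) (constrained_valuation m \<I>) | D.
        \<forall>j. regular_distribution (D j)}"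

definition additive_valuations :: "nat \<Rightarrow> valuation measure set" where
  "additive_valuations m = additive_subject_to m (Pow {..<m})"

text \<open>
  The possible true valuations of a bidder: the topological support of \<open>F\<close>, with
  valuations regarded as points of a finite-dimensional real space.
\<close>

definition valuation_support :: "nat \<Rightarrow> valuation measure \<Rightarrow> valuation set" where
  "valuation_support m F =
     {v \<in> space (valuation_space m). \<forall>e>0.
        0 < emeasure F {w \<in> space (valuation_space m). \<forall>S\<subseteq>{..<m}. \<bar>w S - v S\<bar> < e}}"

subsection \<open>Mechanisms\<close>

text \<open>
  A randomized mechanism draws a seed, independently of the bids, from an arbitrary
  probability distribution on the reals; allocation and payments are then functions of
  seed and bids. A deterministic mechanism ignores the seed.
\<close>

record mechanism =
  seed :: "real measure"
  alloc :: "real \<Rightarrow> bids \<Rightarrow> nat \<Rightarrow> nat set"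
  pay :: "real \<Rightarrow> bids \<Rightarrow> nat \<Rightarrow> real"

definition is_mechanism :: "nat \<Rightarrow> nat \<Rightarrow> mechanism \<Rightarrow> bool" where
  "is_mechanism m n M \<longleftrightarrow>
     real_distribution (seed M) \<and>
     (\<forall>i<n. (\<lambda>(r, b). alloc M r b i)
        \<in> measurable (seed M \<Otimes>\<^sub>M PiM {..<n} (\<lambda>_. valuation_space m)) (count_space (Pow {..<m}))) \<and>
     (\<forall>i<n. (\<lambda>(r, b). pay M r b i)
        \<in> borel_measurable (seed M \<Otimes>\<^sub>M PiM {..<n} (\<lambda>_. valuation_space m))) \<and>
     (\<forall>r. \<forall>b\<in>space (PiM {..<n} (\<lambda>_. valuation_space m)).
        disjoint_family_on (alloc M r b) {..<n})"

text \<open>The seed together with the truthful bids of all bidders in \<open>N\<close>.\<close>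

definition truthful :: "mechanism \<Rightarrow> valuation measure \<Rightarrow> nat set \<Rightarrow> (real \<times> bids) measure" where
  "truthful M F N = seed M \<Otimes>\<^sub>M PiM N (\<lambda>_. F)"

text \<open>
  Payments must have an expectation, both for a bidder who knows her own valuation (and
  considers any report) and before valuations are drawn. Finiteness of the expectation is
  required for each bidder separately: asking it only of the total payment would admit
  transfers that Fubini's theorem does not cover and that make every bidder better off in
  expectation while summing to zero.
\<close>

definition integrable_payments :: "nat \<Rightarrow> nat \<Rightarrow> valuation measure \<Rightarrow> mechanism \<Rightarrow> bool" where
  "integrable_payments m n F M \<longleftrightarrow>
     (\<forall>i<n. integrable (truthful M F {..<n}) (\<lambda>(r, b). pay M r b i)) \<and>
     (\<forall>i<n. \<forall>w\<in>space (valuation_space m).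
        integrable (truthful M F ({..<n} - {i})) (\<lambda>(r, b). pay M r (b(i := w)) i))"

text \<open>Expected utility of bidder \<open>i\<close> with valuation \<open>v\<close> who reports \<open>w\<close>.\<close>

definition expected_utility ::
  "nat \<Rightarrow> valuation measure \<Rightarrow> mechanism \<Rightarrow> nat \<Rightarrow> valuation \<Rightarrow> valuation \<Rightarrow> real" where
  "expected_utility n F M i v w =
     (\<integral>(r, b). v (alloc M r (b(i := w)) i) - pay M r (b(i := w)) i \<partial>truthful M F ({..<n} - {i}))"

definition BIC :: "nat \<Rightarrow> nat \<Rightarrow> valuation measure \<Rightarrow> mechanism \<Rightarrow> bool" where
  "BIC m n F M \<longleftrightarrow>
     (\<forall>i<n. \<forall>v\<in>valuation_support m F. \<forall>w\<in>space (valuation_space m).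
        expected_utility n F M i v w \<le> expected_utility n F M i v v)"

definition BIR :: "nat \<Rightarrow> nat \<Rightarrow> valuation measure \<Rightarrow> mechanism \<Rightarrow> bool" where
  "BIR m n F M \<longleftrightarrow>
     (\<forall>i<n. \<forall>v\<in>valuation_support m F. 0 \<le> expected_utility n F M i v v)"

text \<open>
  The Bochner integral is 0 on non-integrable functions; the extended expectation is
  \<open>\<infinity>\<close> on non-negative ones.
\<close>

definition extended_expectation :: "'a measure \<Rightarrow> ('a \<Rightarrow> real) \<Rightarrow> ereal" where
  "extended_expectation M f =
     enn2ereal (\<integral>\<^sup>+x. ennreal (f x) \<partial>M) - enn2ereal (\<integral>\<^sup>+x. ennreal (- f x) \<partial>M)"

definition Rev :: "mechanism \<Rightarrow> valuation measure \<Rightarrow> nat \<Rightarrow> ereal" where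
  "Rev M F k = extended_expectation (truthful M F {..<k}) (\<lambda>(r, b). \<Sum>i<k. pay M r b i)"

definition OPT :: "nat \<Rightarrow> valuation measure \<Rightarrow> nat \<Rightarrow> ereal" where
  "OPT m F n =
     (SUP M \<in> {M. is_mechanism m n M \<and> integrable_payments m n F M \<and> BIC m n F M \<and> BIR m n F M}.
        Rev M F n)"

subsection \<open>VCG\<close>

definition allocations :: "nat \<Rightarrow> nat set \<Rightarrow> (nat \<Rightarrow> nat set) set" where
  "allocations m N = {A \<in> N \<rightarrow>\<^sub>E Pow {..<m}. disjoint_family_on A N}"

definition welfare :: "nat set \<Rightarrow> bids \<Rightarrow> (nat \<Rightarrow> nat set) \<Rightarrow> real" where
  "welfare N b A = (\<Sum>i\<in>N. b i (A i))"

definition max_welfare :: "nat \<Rightarrow> nat set \<Rightarrow> bids \<Rightarrow> real" where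
  "max_welfare m N b = Max (welfare N b ` allocations m N)"

text \<open>
  Ties are broken by the choice operator. The total payment does not depend on how: it
  equals the sum of the maximum welfares with one bidder removed, minus \<open>k - 1\<close> times
  the maximum welfare of all \<open>k\<close> bidders.
\<close>

definition vcg_alloc :: "nat \<Rightarrow> nat \<Rightarrow> bids \<Rightarrow> nat \<Rightarrow> nat set" where
  "vcg_alloc m k b = arg_max_on (welfare {..<k} b) (allocations m {..<k})"

definition vcg_pay :: "nat \<Rightarrow> nat \<Rightarrow> bids \<Rightarrow> nat \<Rightarrow> real" where
  "vcg_pay m k b i =
     max_welfare m ({..<k} - {i}) b - welfare ({..<k} - {i}) b (vcg_alloc m k b)"

definition VCG :: "nat \<Rightarrow> nat \<Rightarrow> mechanism" where
  "VCG m k = \<lparr>seed = return borel 0, alloc = (\<lambda>_. vcg_alloc m k), pay = (\<lambda>_. vcg_pay m k)\<rparr>"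

subsection \<open>Competition complexity\<close>

text \<open>The least such \<open>c\<close>, or \<open>\<infinity>\<close> if there is none.\<close>

definition competition_complexity :: "nat \<Rightarrow> nat \<Rightarrow> valuation measure set \<Rightarrow> enat" where
  "competition_complexity m n \<D> =
     (INF c \<in> {c. \<forall>F\<in>\<D>. OPT m F n \<le> Rev (VCG m (n + c)) F (n + c)}. enat c)"

end

theory Submission
  imports Defs
begin

text \<open>
  An additive bidder who is only ever given independent sets behaves like a constrained one, so
  every mechanism for the constrained market can be run in the additive market. It remains to
  compare the VCG revenue of \<open>k\<close> additive bidders, the sum over the items of the runner-up
  values, with that of \<open>k + \<rho>\<close> constrained bidders.

  In the latter market, the externality of a bidder \<open>i\<close> who wins the set \<open>T\<close> telescopes over
  \<open>j \<in> T\<close> when the items of \<open>T\<close> are returned to the others one by one. Returning \<open>j\<close> is worth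
  at least the largest value for \<open>j\<close> among the bidders whose current bundle does not span \<open>j\<close>.
  The spanning bundles form a disjoint spanning collection, so at least \<open>k - 1\<close> bidders
  other than \<open>i\<close> remain. Given all values for items other than \<open>j\<close>, these
  bidders depend only on who wins \<open>j\<close>, and the winner is the bidder whose value for \<open>j\<close> plus a
  constant handicap is largest. Since the values for \<open>j\<close> are independent and identically distributed, the
  largest value among \<open>k - 1\<close> competitors of the winner is smallest in expectation for the
  competitors with the best handicaps, and for those it is at least a runner-up among \<open>k\<close> bidders.
\<close>

text \<open>The handicap argument needs the competitors of the winner of \<open>j\<close> to be
  fixed before the values for \<open>j\<close> are seen. They are therefore read off an optimal
  allocation, among the other bidders, of the items available before \<open>j\<close> is returned;
  no value for \<open>j\<close> enters there. The number \<rho> bounds the bidders whose bundle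
  cannot absorb \<open>j\<close>: besides the winner there are \<open>k - 1 + \<rho>\<close>
  constrained bidders, so \<open>k - 1\<close> of them can still take \<open>j\<close>.

  VCG's own allocation comes from a choice operator: it need not be measurable, and it may leave
  items unsold. Its total payment is the same for every optimal allocation, so the proof prices one
  that hands out every item it can. Ranks break all ties, so every point has exactly one winner and
  no null set of ties has to be discarded.

  Loops, the items \<open>j\<close> with \<open>{j} \<notin> \<I>\<close>, are the obstacle: every
  bundle without \<open>j\<close> spans \<open>j\<close> and nobody can win it, yet the additive
  market sells it. Constrained valuations ignore the values of loops, so these are redrawn uniformly
  from \<open>{0..e}\<close>, and \<open>e\<close> tends to 0 at the end.\<close>

subsection \<open>Choosing among finitely many alternatives\<close>

definition lex_better :: "('a \<Rightarrow> real) \<Rightarrow> ('a \<Rightarrow> nat) \<Rightarrow> 'a \<Rightarrow> 'a \<Rightarrow> bool" where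
  "lex_better w r a b \<longleftrightarrow> w b < w a \<or> w b = w a \<and> r a < r b"

definition lex_best :: "'a set \<Rightarrow> ('a \<Rightarrow> real) \<Rightarrow> ('a \<Rightarrow> nat) \<Rightarrow> 'a" where
  "lex_best A w r = (THE a. a \<in> A \<and> (\<forall>b\<in>A - {a}. lex_better w r a b))"

lemma lex_better_trans: "lex_better w r a b \<Longrightarrow> lex_better w r b c \<Longrightarrow> lex_better w r a c"
  by (auto simp: lex_better_def)

lemma lex_better_asym: "lex_better w r a b \<Longrightarrow> \<not> lex_better w r b a"
  by (auto simp: lex_better_def)

lemma lex_best_ex1:
  assumes "finite A" "A \<noteq> {}" "inj_on r A"
  shows "\<exists>!a. a \<in> A \<and> (\<forall>b\<in>A - {a}. lex_better w r a b)"
proof -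
  define B where "B = {a \<in> A. w a = Max (w ` A)}"
  have "Max (w ` A) \<in> w ` A" using assms by (intro Max_in) auto
  then have B: "finite B" "B \<noteq> {}" unfolding B_def using assms(1) by auto
  have "Min (r ` B) \<in> r ` B" using B by (intro Min_in) auto
  then obtain a where a: "a \<in> B" "r a = Min (r ` B)" by auto
  have "lex_better w r a b" if b: "b \<in> A" "b \<noteq> a" for b
  proof (cases "b \<in> B")
    case True
    have "r a \<le> r b" unfolding a(2) using B(1) True by (intro Min_le) auto
    moreover have "r a \<noteq> r b" using assms(3) b a(1) unfolding B_def inj_on_def by auto
    ultimately show ?thesis using True a(1) unfolding lex_better_def B_def by auto
  next
    case False
    have "w b \<le> Max (w ` A)" using assms(1) b by (intro Max_ge) auto
    then show ?thesis using False a(1) b unfolding lex_better_def B_def by auto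
  qed
  then have ex: "a \<in> A \<and> (\<forall>b\<in>A - {a}. lex_better w r a b)"
    using a(1) unfolding B_def by auto
  have "c = a" if "c \<in> A \<and> (\<forall>b\<in>A - {c}. lex_better w r c b)" for c
    using that ex lex_better_asym by (metis Diff_iff singletonD)
  then show ?thesis using ex by blast
qed

lemma lex_best_props:
  assumes "finite A" "A \<noteq> {}" "inj_on r A"
  shows lex_best_in: "lex_best A w r \<in> A"
    and lex_best_better: "b \<in> A \<Longrightarrow> b \<noteq> lex_best A w r \<Longrightarrow> lex_better w r (lex_best A w r) b"
  using theI'[OF lex_best_ex1[OF assms, of w]] unfolding lex_best_def by auto

lemma lex_best_eqI:
  assumes "finite A" "inj_on r A" "a \<in> A" "\<And>b. b \<in> A \<Longrightarrow> b \<noteq> a \<Longrightarrow> lex_better w r a b"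
  shows "lex_best A w r = a"
  unfolding lex_best_def by (rule the1_equality[OF lex_best_ex1]) (use assms in auto)

lemma lex_best_max:
  assumes "finite A" "A \<noteq> {}" "inj_on r A" "b \<in> A"
  shows "w b \<le> w (lex_best A w r)"
  using lex_best_better[OF assms(1-4), of w] by (cases "b = lex_best A w r") (auto simp: lex_better_def)

lemma pred_lex_better [measurable (raw)]:
  assumes [measurable]: "(\<lambda>x. w x a) \<in> borel_measurable M" "(\<lambda>x. w x b) \<in> borel_measurable M"
  shows "Measurable.pred M (\<lambda>x. lex_better (w x) r a b)"
proof -
  have "lex_better (w x) r a b \<longleftrightarrow> w x b \<le> w x a \<and> (w x b < w x a \<or> r a < r b)" for x
    by (auto simp: lex_better_def)
  then show ?thesis by simp
qed

text \<open>The set of points with a given best alternative is cut out by finitely many comparisons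
  of measurable weights.\<close>

lemma measurable_lex_best:
  assumes A: "finite A" "A \<noteq> {}" "inj_on r A" and w: "\<And>a. a \<in> A \<Longrightarrow> (\<lambda>x. w x a) \<in> borel_measurable M"
  shows "(\<lambda>x. lex_best A (w x) r) \<in> measurable M (count_space A)"
proof (subst measurable_count_space_eq2[OF A(1)], intro conjI ballI)
  show "(\<lambda>x. lex_best A (w x) r) \<in> space M \<rightarrow> A" using lex_best_in[OF A] by auto
  fix a assume a: "a \<in> A"
  have "(\<lambda>x. lex_best A (w x) r) -` {a} \<inter> space M = {x \<in> space M. \<forall>b\<in>A - {a}. lex_better (w x) r a b}"
    using lex_best_eqI[OF A(1,3) a] lex_best_better[OF A] by auto
  also have "\<dots> \<in> sets M"
    using A(1) w a by (intro sets.sets_Collect_finite_All' predE pred_lex_better) auto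
  finally show "(\<lambda>x. lex_best A (w x) r) -` {a} \<inter> space M \<in> sets M" .
qed

lemma top_set_exists:
  assumes "finite N" "inj_on r N" "k \<le> card N"
  shows "\<exists>K\<subseteq>N. card K = k \<and> (\<forall>a\<in>K. \<forall>b\<in>N - K. lex_better g r a b)"
  using assms(3)
proof (induction k)
  case 0
  show ?case by (intro exI[of _ "{}"]) auto
next
  case (Suc k)
  then obtain K where K: "K \<subseteq> N" "card K = k" "\<forall>a\<in>K. \<forall>b\<in>N - K. lex_better g r a b" by auto
  have fK: "finite K" using K(1) assms(1) by (rule finite_subset)
  have ne: "N - K \<noteq> {}" using K Suc.prems by auto
  define c where "c = lex_best (N - K) g r"
  have inj: "inj_on r (N - K)" using assms(2) by (rule inj_on_subset) auto
  have c: "c \<in> N - K" unfolding c_def using assms(1) ne inj by (intro lex_best_in) auto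
  have "lex_better g r c b" if "b \<in> N - insert c K" for b
    unfolding c_def using assms(1) ne inj that by (intro lex_best_better) (auto simp: c_def)
  then show ?case using K c fK by (intro exI[of _ "insert c K"]) auto
qed

subsection \<open>Competition for a single item\<close>

text \<open>The extra \<open>0\<close> stands for leaving the item unsold. It also gives an empty
  set of competitors the price 0.\<close>

definition peak :: "'a set \<Rightarrow> ('a \<Rightarrow> real) \<Rightarrow> real" where
  "peak U x = Max (insert 0 (x ` U))"

text \<open>This is the second largest value, with multiplicity and never below 0: the minimum is
  attained by removing a bidder with the largest value. For a single bidder it is 0.\<close>

definition runner_up :: "'a set \<Rightarrow> ('a \<Rightarrow> real) \<Rightarrow> real" where
  "runner_up K x = Min ((\<lambda>c. peak (K - {c}) x) ` K)"

lemma peak_empty [simp]: "peak {} x = 0"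
  by (simp add: peak_def)

lemma peak_insert: "finite U \<Longrightarrow> peak (insert a U) x = max (x a) (peak U x)"
  unfolding peak_def image_insert by (subst insert_commute) (simp add: max.left_commute)

lemma peak_nonneg: "finite U \<Longrightarrow> 0 \<le> peak U x"
  by (simp add: peak_def)

lemma peak_ge: "finite U \<Longrightarrow> a \<in> U \<Longrightarrow> x a \<le> peak U x"
  by (simp add: peak_def)

lemma peak_le: "finite U \<Longrightarrow> 0 \<le> c \<Longrightarrow> (\<And>a. a \<in> U \<Longrightarrow> x a \<le> c) \<Longrightarrow> peak U x \<le> c"
  by (auto simp: peak_def)

lemma peak_mono: "finite V \<Longrightarrow> U \<subseteq> V \<Longrightarrow> peak U x \<le> peak V x"
  by (intro peak_le peak_nonneg peak_ge) (auto intro: finite_subset)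

lemma peak_cong: "(\<And>a. a \<in> U \<Longrightarrow> x a = y a) \<Longrightarrow> peak U x = peak U y"
  unfolding peak_def by (metis image_cong)

lemma peak_reindex: "peak U (\<lambda>a. x (f a)) = peak (f ` U) x"
  unfolding peak_def by (simp add: image_image)

lemma borel_measurable_peak [measurable (raw)]:
  assumes "finite U" "\<And>a. a \<in> U \<Longrightarrow> (\<lambda>x. f x a) \<in> borel_measurable M"
  shows "(\<lambda>x. peak U (f x)) \<in> borel_measurable M"
  using assms by (induction U rule: finite_induct) (auto simp: peak_insert)

lemma runner_up_reindex:
  assumes "inj_on f K"
  shows "runner_up K (\<lambda>a. x (f a)) = runner_up (f ` K) x"
proof -
  have "peak (K - {c}) (\<lambda>a. x (f a)) = peak (f ` K - {f c}) x" if "c \<in> K" for c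
    unfolding peak_reindex using assms that by (simp add: inj_on_image_set_diff[of f K])
  then show ?thesis unfolding runner_up_def image_image by simp
qed

lemma runner_up_le:
  assumes "finite K" "c \<in> K"
  shows "runner_up K x \<le> peak (K - {c}) x"
  unfolding runner_up_def using assms by (intro Min_le) auto

lemma runner_up_nonneg: "finite K \<Longrightarrow> K \<noteq> {} \<Longrightarrow> 0 \<le> runner_up K x"
  unfolding runner_up_def by (auto intro: peak_nonneg)

lemma runner_up_cong: "(\<And>a. a \<in> K \<Longrightarrow> x a = y a) \<Longrightarrow> runner_up K x = runner_up K y"
  unfolding runner_up_def by (intro arg_cong[where f=Min] image_cong refl peak_cong) auto

lemma borel_measurable_runner_up [measurable (raw)]:
  assumes "finite K" "K \<noteq> {}" "\<And>a. a \<in> K \<Longrightarrow> (\<lambda>x. f x a) \<in> borel_measurable M"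
  shows "(\<lambda>x. runner_up K (f x)) \<in> borel_measurable M"
  unfolding runner_up_def using assms by (intro borel_measurable_Min borel_measurable_peak) auto

text \<open>This computes the VCG revenue of one item sold to additive bidders \<open>K\<close>.
  Removing anyone but one fixed bidder of largest value leaves the peak unchanged; removing that
  bidder leaves the runner-up.\<close>

lemma sum_peak_remove:
  assumes "finite K" "K \<noteq> {}"
  shows "(\<Sum>c\<in>K. peak (K - {c}) x) = (real (card K) - 1) * peak K x + runner_up K x"
proof -
  have "\<exists>a\<in>K. \<forall>c\<in>K - {a}. peak (K - {c}) x = peak K x"
  proof -
    obtain a where a: "a \<in> K" "\<And>c. c \<in> K \<Longrightarrow> x c \<le> x a"
    proof -
      have "Max (x ` K) \<in> x ` K" using assms by (intro Max_in) auto
      then obtain a where "a \<in> K" "x a = Max (x ` K)" by auto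
      with assms that show ?thesis by auto
    qed
    have "peak (K - {c}) x = peak K x" if "c \<in> K - {a}" for c
    proof (rule antisym)
      show "peak (K - {c}) x \<le> peak K x" using assms by (intro peak_mono) auto
      have "x b \<le> peak (K - {c}) x" if "b \<in> K" for b
        using a(2)[OF that] peak_ge[of "K - {c}" a x] a(1) assms \<open>c \<in> K - {a}\<close> by auto
      then show "peak K x \<le> peak (K - {c}) x" using assms by (intro peak_le peak_nonneg) auto
    qed
    with a(1) show ?thesis by blast
  qed
  then obtain a where a: "a \<in> K" "\<And>c. c \<in> K - {a} \<Longrightarrow> peak (K - {c}) x = peak K x" by blast
  have "runner_up K x = peak (K - {a}) x"
    unfolding runner_up_def
  proof (rule Min_eqI)
    fix y assume "y \<in> (\<lambda>c. peak (K - {c}) x) ` K"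
    then obtain c where c: "c \<in> K" "y = peak (K - {c}) x" by auto
    show "peak (K - {a}) x \<le> y"
      using a(2)[of c] c peak_mono[of K "K - {a}" x] assms by (cases "c = a") auto
  qed (use assms a in auto)
  moreover have "(\<Sum>c\<in>K. peak (K - {c}) x) = peak (K - {a}) x + (\<Sum>c\<in>K - {a}. peak K x)"
    using assms a by (simp add: sum.remove[of K a])
  moreover have "real (card (K - {a})) = real (card K) - 1"
    using assms a by (simp add: card_gt_0_iff of_nat_diff Suc_leI)
  ultimately show ?thesis by simp
qed

section \<open>A contest with handicaps for one item among bidders with i.i.d. values\<close>

definition wins :: "'a set \<Rightarrow> ('a \<Rightarrow> real) \<Rightarrow> ('a \<Rightarrow> nat) \<Rightarrow> 'a \<Rightarrow> ('a \<Rightarrow> real) set" where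
  "wins N g r i = {x. \<forall>c\<in>N - {i}. lex_better (\<lambda>c. x c + g c) r i c}"

context
  fixes D :: "real measure" and N :: "'a set"
  assumes D: "prob_space D" "sets D = sets borel" and N: "finite N"
begin

lemma measurable_iid_component [measurable (raw)]:
  "c \<in> N \<Longrightarrow> (\<lambda>x. x c) \<in> borel_measurable (PiM N (\<lambda>_. D))"
  using measurable_component_singleton[of c N "\<lambda>_. D"] by (simp add: D(2) cong: measurable_cong_sets)

lemma borel_measurable_indicator_wins:
  assumes "i \<in> N"
  shows "(indicator (wins N g r i) :: ('a \<Rightarrow> real) \<Rightarrow> ennreal) \<in> borel_measurable (PiM N (\<lambda>_. D))"
proof -
  have "Measurable.pred (PiM N (\<lambda>_. D)) (\<lambda>x. x \<in> wins N g r i)"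
    unfolding wins_def mem_Collect_eq
  proof (rule pred_intros_finite)
    fix c assume "c \<in> N - {i}"
    then have [measurable]: "c \<in> N" "i \<in> N" using assms by auto
    show "Measurable.pred (PiM N (\<lambda>_. D)) (\<lambda>x. lex_better (\<lambda>c. x c + g c) r i c)"
      by measurable
  qed (use N in simp)
  then have "{x \<in> space (PiM N (\<lambda>_. D)). x \<in> wins N g r i} \<in> sets (PiM N (\<lambda>_. D))"
    by (simp add: pred_def)
  then show ?thesis
    using borel_measurable_indicator_iff[of "wins N g r i" "PiM N (\<lambda>_. D)"]
    by (simp add: Int_def conj_commute)
qed

lemma nn_integral_iid_reindex:
  assumes f: "f \<in> borel_measurable (PiM N (\<lambda>_. D))" and p: "bij_betw p N N"
  shows "(\<integral>\<^sup>+x. f (\<lambda>n\<in>N. x (p n)) \<partial>PiM N (\<lambda>_. D)) = (\<integral>\<^sup>+x. f x \<partial>PiM N (\<lambda>_. D))"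
proof -
  have d: "distr (PiM N (\<lambda>_. D)) (PiM N (\<lambda>_. D)) (\<lambda>x. \<lambda>n\<in>N. x (p n)) = PiM N (\<lambda>_. D)"
    using p by (intro distr_PiM_reindex) (auto simp: D bij_betw_def)
  have m: "(\<lambda>x. \<lambda>n\<in>N. x (p n)) \<in> measurable (PiM N (\<lambda>_. D)) (PiM N (\<lambda>_. D))"
    using p by (intro measurable_restrict measurable_component_singleton) (auto simp: bij_betw_def)
  show ?thesis
    using nn_integral_distr[OF m, unfolded d, OF f] by simp
qed

text \<open>
  Exchanging the values of \<open>a\<close> and \<open>b\<close> preserves the measure, and if \<open>i\<close> still wins after
  the larger of the two values has been moved to the better placed competitor, then \<open>i\<close>
  also won before; so on balance the winner competes against larger values of \<open>b\<close>.
\<close>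

lemma nn_integral_wins_exchange:
  assumes ab: "a \<in> N" "b \<in> N" "a \<noteq> i" "b \<noteq> i" "i \<in> N" and better: "lex_better g r a b"
    and Q: "Q \<subseteq> N" "a \<notin> Q" "b \<notin> Q"
  shows "(\<integral>\<^sup>+x. indicator (wins N g r i) x * ennreal (peak (insert a Q) x) \<partial>PiM N (\<lambda>_. D)) \<le>
    (\<integral>\<^sup>+x. indicator (wins N g r i) x * ennreal (peak (insert b Q) x) \<partial>PiM N (\<lambda>_. D))"
    (is "integral\<^sup>N ?P ?fa \<le> integral\<^sup>N ?P ?fb")
proof -
  have neq: "a \<noteq> b" using better by (auto simp: lex_better_def)
  have fQ: "finite Q" using Q(1) N by (rule finite_subset)
  define p where "p = Transposition.transpose a b"
  define s where "s x = (\<lambda>n\<in>N. x (p n))" for x :: "'a \<Rightarrow> real"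
  have p: "bij_betw p N N"
  proof (rule bij_betwI[of _ _ _ p])
    show "p \<in> N \<rightarrow> N" "p \<in> N \<rightarrow> N"
      using ab by (auto simp: p_def Transposition.transpose_def)
  qed (auto simp: p_def)
  note [measurable] = borel_measurable_indicator_wins[OF ab(5)]
  have sub: "insert a Q \<subseteq> N" "insert b Q \<subseteq> N" using ab Q by auto
  have [measurable]: "?fa \<in> borel_measurable ?P" "?fb \<in> borel_measurable ?P"
    using fQ sub by (auto intro!: borel_measurable_times_ennreal borel_measurable_indicator_wins
        measurable_compose[OF _ measurable_ennreal] borel_measurable_peak ab(5) measurable_iid_component)
  have sa: "s x a = x b" "s x b = x a" and sc: "c \<in> N \<Longrightarrow> c \<noteq> a \<Longrightarrow> c \<noteq> b \<Longrightarrow> s x c = x c" for x c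
    using ab by (auto simp: s_def p_def)
  have pQ: "peak Q (s x) = peak Q x" for x
    using Q sc by (intro peak_cong) auto
  have imp: "x \<in> wins N g r i" if le: "x a \<le> x b" and w: "s x \<in> wins N g r i" for x
    unfolding wins_def
  proof (intro CollectI ballI)
    fix c assume "c \<in> N - {i}"
    then have c: "c \<in> N" "c \<noteq> i" by auto
    have wa: "lex_better (\<lambda>c. s x c + g c) r i a" and wc: "lex_better (\<lambda>c. s x c + g c) r i c"
      using w c ab unfolding wins_def by auto
    have si: "s x i = x i" using sc ab by auto
    consider "c = a" | "c = b" | "c \<noteq> a" "c \<noteq> b" by blast
    then show "lex_better (\<lambda>c. x c + g c) r i c"
    proof cases
      case 1 with wa si sa le show ?thesis by (auto simp: lex_better_def)
    next
      case 2 with wa si sa better show ?thesis by (auto simp: lex_better_def)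
    next
      case 3 with wc si sc c show ?thesis by (auto simp: lex_better_def)
    qed
  qed
  have ss: "s (s x) c = x c" if "c \<in> N" for x c
  proof -
    have "p c \<in> N" using p that by (auto simp: bij_betw_def)
    then show ?thesis using that by (simp add: s_def p_def)
  qed
  have imp': "s x \<in> wins N g r i" if le: "x b \<le> x a" and w: "x \<in> wins N g r i" for x
  proof (rule imp)
    show "s x a \<le> s x b" using le sa by simp
    show "s (s x) \<in> wins N g r i" using w ss ab(5) unfolding wins_def by (auto simp: lex_better_def)
  qed
  \<comment> \<open>Under the exchange \<open>s\<close> the two peaks trade places. If
    \<open>i\<close> wins at both points or at neither, the two sides agree; otherwise
    \<open>i\<close> wins only at the point where \<open>b\<close> has the larger value, and there
    the right-hand side has the larger peak.\<close>
  have pw: "?fa x + ?fa (s x) \<le> ?fb x + ?fb (s x)" for x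
  proof (cases "x a \<le> x b")
    case True
    then have "peak (insert a Q) x \<le> peak (insert b Q) x" using fQ by (simp add: peak_insert)
    moreover have "peak (insert a Q) (s x) = peak (insert b Q) x" "peak (insert b Q) (s x) = peak (insert a Q) x"
      using fQ by (simp_all add: peak_insert pQ sa)
    ultimately show ?thesis using imp[OF True]
      by (auto simp: indicator_def ennreal_leI add.commute)
  next
    case False
    then have "peak (insert b Q) x \<le> peak (insert a Q) x" using fQ by (simp add: peak_insert)
    moreover have "peak (insert a Q) (s x) = peak (insert b Q) x" "peak (insert b Q) (s x) = peak (insert a Q) x"
      using fQ by (simp_all add: peak_insert pQ sa)
    ultimately show ?thesis using imp'[of x] False
      by (auto simp: indicator_def ennreal_leI add.commute)
  qed
  have [measurable]: "s \<in> measurable ?P ?P"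
    unfolding s_def[abs_def] using p
    by (intro measurable_restrict measurable_component_singleton) (auto simp: bij_betw_def)
  have eq: "integral\<^sup>N ?P f + integral\<^sup>N ?P f = (\<integral>\<^sup>+x. f x + f (s x) \<partial>?P)"
    if [measurable]: "f \<in> borel_measurable ?P" for f
    using nn_integral_iid_reindex[OF that p] by (simp add: nn_integral_add s_def[symmetric])
  have "integral\<^sup>N ?P ?fa + integral\<^sup>N ?P ?fa \<le> integral\<^sup>N ?P ?fb + integral\<^sup>N ?P ?fb"
    unfolding eq[OF \<open>?fa \<in> _\<close>] eq[OF \<open>?fb \<in> _\<close>] by (intro nn_integral_mono pw)
  then show ?thesis
    by (simp add: mult_2[symmetric] ennreal_mult_le_mult_iff)
qed

text \<open>The set \<open>U\<close> is turned into a superset of \<open>K\<close> one exchange at a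
  time: some \<open>b\<close> in \<open>U - K\<close> gives way to some \<open>a\<close> in
  \<open>K - U\<close>, which does not increase the integral because \<open>a\<close> is better
  placed. Such a \<open>b\<close> exists because \<open>U\<close> has at least as many elements as
  \<open>K\<close>.\<close>

lemma nn_integral_wins_top_set:
  assumes i: "i \<in> N" and K: "K \<subseteq> N - {i}" and U: "U \<subseteq> N - {i}" and card: "card K \<le> card U"
    and top: "\<And>a b. a \<in> K \<Longrightarrow> b \<in> N - {i} - K \<Longrightarrow> lex_better g r a b"
  shows "(\<integral>\<^sup>+x. indicator (wins N g r i) x * ennreal (peak K x) \<partial>PiM N (\<lambda>_. D)) \<le>
    (\<integral>\<^sup>+x. indicator (wins N g r i) x * ennreal (peak U x) \<partial>PiM N (\<lambda>_. D))"
    (is "?I K \<le> ?I U")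
  using U card
proof (induction "card (K - U)" arbitrary: U)
  have fin: "finite V" if "V \<subseteq> N - {i}" for V
    using that N by (meson finite_Diff finite_subset)
  {
    case 0
    then have "K \<subseteq> U" using fin[OF K] by auto
    then show ?case
      using fin[OF 0(2)] by (intro nn_integral_mono mult_left_mono ennreal_leI peak_mono) auto
  next
    case (Suc k)
    have fU: "finite U" and fK: "finite K" using fin Suc.prems(1) K by auto
    from Suc(2) obtain a where a: "a \<in> K" "a \<notin> U"
      by (metis Diff_iff all_not_in_conv card.empty nat.distinct(1))
    have "\<not> U \<subseteq> K"
    proof
      assume "U \<subseteq> K"
      with a have "U \<subset> K" by auto
      from psubset_card_mono[OF fK this] Suc.prems(2) show False by simp
    qed
    then obtain b where b: "b \<in> U" "b \<notin> K" by auto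
    define Q where "Q = U - {b}"
    have U: "U = insert b Q" using b by (auto simp: Q_def)
    have "K - insert a Q = (K - U) - {a}" using b by (auto simp: Q_def)
    then have "k = card (K - insert a Q)" using Suc(2) a fK by simp
    moreover have "card (insert a Q) = card U"
      using a b fU by (simp add: Q_def card_gt_0_iff) (metis Suc_pred card_gt_0_iff empty_iff)
    ultimately have "?I K \<le> ?I (insert a Q)"
      using Suc.prems a K by (intro Suc(1)) (auto simp: Q_def)
    also have "\<dots> \<le> ?I (insert b Q)"
      using a b K Suc.prems i top[of a b] by (intro nn_integral_wins_exchange) (auto simp: Q_def)
    finally show ?case using U by simp
  }
qed

lemma ex_wins:
  assumes "N \<noteq> {}" "inj_on r N"
  shows "\<exists>i\<in>N. x \<in> wins N g r i"
  using lex_best_ex1[OF N assms, of "\<lambda>c. x c + g c"] unfolding wins_def by auto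

text \<open>
  By exchanging, the winner \<open>i\<close> may be taken to compete against the best placed others \<open>T i\<close>.
  These contain the best placed \<open>k + 1\<close> bidders \<open>K1\<close> up to one, so their peak is at least the
  runner-up of \<open>K1\<close>.
\<close>

lemma nn_integral_runner_up_le:
  assumes r: "inj_on r N" and U: "\<And>i. i \<in> N \<Longrightarrow> U i \<subseteq> N - {i}" "\<And>i. i \<in> N \<Longrightarrow> k \<le> card (U i)"
    and K0: "K0 \<subseteq> N" "card K0 = Suc k"
  shows "(\<integral>\<^sup>+x. ennreal (runner_up K0 x) \<partial>PiM N (\<lambda>_. D)) \<le>
    (\<Sum>i\<in>N. \<integral>\<^sup>+x. indicator (wins N g r i) x * ennreal (peak (U i) x) \<partial>PiM N (\<lambda>_. D))"
proof -
  have ne: "N \<noteq> {}" and kN: "Suc k \<le> card N" using K0 card_mono[OF N K0(1)] by auto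
  obtain K where K: "K \<subseteq> N" "card K = k" "\<And>a b. a \<in> K \<Longrightarrow> b \<in> N - K \<Longrightarrow> lex_better g r a b"
    using top_set_exists[OF N r, of k g] kN by auto
  have fK: "finite K" using K(1) N by (rule finite_subset)
  have ne': "N - K \<noteq> {}" using K kN by auto
  define c where "c = lex_best (N - K) g r"
  have r': "inj_on r (N - K)" using r by (rule inj_on_subset) auto
  have c: "c \<in> N - K" unfolding c_def using N ne' r' by (intro lex_best_in) auto
  have cb: "lex_better g r c b" if "b \<in> N - K" "b \<noteq> c" for b
    unfolding c_def using N ne' r' that by (intro lex_best_better) (auto simp: c_def)
  define K1 where "K1 = insert c K"
  \<comment> \<open>\<open>T i\<close> consists of the \<open>k\<close> best placed bidders other
    than \<open>i\<close>; if \<open>i\<close> is among the top \<open>k\<close>, then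
    \<open>c\<close>, the next in line, takes the vacant place.\<close>
  define T where "T i = (if i \<in> K then K1 - {i} else K)" for i
  have K1: "K1 \<subseteq> N" "card K1 = Suc k" "finite K1" using K c fK by (auto simp: K1_def)
  \<comment> \<open>The values are exchangeable, so the expected runner-up of a set depends only on
    its size, and \<open>K0\<close> may be replaced by the best placed set
    \<open>K1\<close>.\<close>
  obtain p where p: "bij_betw p N N" "p ` K1 = K0"
  proof -
    have fK0: "finite K0" using K0(1) N by (rule finite_subset)
    obtain p1 where p1: "bij_betw p1 K1 K0"
      using K1 K0 fK0 by (metis finite_same_card_bij)
    have "card (N - K1) = card (N - K0)"
      using K1 K0 fK0 by (simp add: card_Diff_subset)
    then obtain p2 where p2: "bij_betw p2 (N - K1) (N - K0)"
      using N by (metis finite_Diff finite_same_card_bij)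
    have "bij_betw (\<lambda>x. if x \<in> K1 then p1 x else p2 x) (K1 \<union> (N - K1)) (K0 \<union> (N - K0))"
      by (rule bij_betw_disjoint_Un[OF p1 p2]) auto
    moreover have "K1 \<union> (N - K1) = N" "K0 \<union> (N - K0) = N" using K1 K0 by auto
    moreover have "(\<lambda>x. if x \<in> K1 then p1 x else p2 x) ` K1 = K0"
      using p1 by (auto simp: bij_betw_def)
    ultimately show ?thesis using that by simp
  qed
  have ru[measurable]: "(\<lambda>x. ennreal (runner_up K' x)) \<in> borel_measurable (PiM N (\<lambda>_. D))"
    if "K' \<subseteq> N" "K' \<noteq> {}" for K'
    using that N by (intro measurable_compose[OF _ measurable_ennreal] borel_measurable_runner_up
        measurable_iid_component) (auto intro: finite_subset)
  have K0ne: "K0 \<noteq> {}" and K1ne: "K1 \<noteq> {}" using K0 by (auto simp: K1_def)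
  have "(\<integral>\<^sup>+x. ennreal (runner_up K0 x) \<partial>PiM N (\<lambda>_. D)) =
      (\<integral>\<^sup>+x. ennreal (runner_up K1 (\<lambda>n\<in>N. x (p n))) \<partial>PiM N (\<lambda>_. D))"
  proof -
    have "runner_up K1 (\<lambda>n\<in>N. x (p n)) = runner_up K0 x" for x
    proof -
      have "runner_up K1 (\<lambda>n\<in>N. x (p n)) = runner_up K1 (\<lambda>n. x (p n))"
        using K1 by (intro runner_up_cong) auto
      also have "\<dots> = runner_up (p ` K1) x"
        using p K1 by (intro runner_up_reindex) (auto simp: bij_betw_def intro: inj_on_subset)
      finally show ?thesis using p by simp
    qed
    then show ?thesis by simp
  qed
  also have "\<dots> = (\<integral>\<^sup>+x. ennreal (runner_up K1 x) \<partial>PiM N (\<lambda>_. D))"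
    by (rule nn_integral_iid_reindex[OF ru[OF K1(1) K1ne] p(1)])
  also have "\<dots> \<le> (\<integral>\<^sup>+x. (\<Sum>i\<in>N. indicator (wins N g r i) x * ennreal (peak (T i) x)) \<partial>PiM N (\<lambda>_. D))"
  proof (rule nn_integral_mono)
    fix x
    obtain i where i: "i \<in> N" "x \<in> wins N g r i" using ex_wins[OF ne r] by blast
    have "\<exists>d\<in>K1. T i = K1 - {d}"
      using c by (cases "i \<in> K") (auto simp: T_def K1_def)
    then have "runner_up K1 x \<le> peak (T i) x" using runner_up_le[OF K1(3)] by auto
    then have "ennreal (runner_up K1 x) \<le> indicator (wins N g r i) x * ennreal (peak (T i) x)"
      using i by (simp add: ennreal_leI)
    also have "\<dots> \<le> (\<Sum>i\<in>N. indicator (wins N g r i) x * ennreal (peak (T i) x))"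
      using i N by (intro member_le_sum) auto
    finally show "ennreal (runner_up K1 x) \<le> (\<Sum>i\<in>N. indicator (wins N g r i) x * ennreal (peak (T i) x))" .
  qed
  also have "\<dots> = (\<Sum>i\<in>N. \<integral>\<^sup>+x. indicator (wins N g r i) x * ennreal (peak (T i) x) \<partial>PiM N (\<lambda>_. D))"
  proof (rule nn_integral_sum)
    fix i assume i: "i \<in> N"
    have "T i \<subseteq> N" "finite (T i)" using K K1 fK by (auto simp: T_def)
    then show "(\<lambda>x. indicator (wins N g r i) x * ennreal (peak (T i) x)) \<in> borel_measurable (PiM N (\<lambda>_. D))"
      using i by (intro borel_measurable_times_ennreal borel_measurable_indicator_wins
        measurable_compose[OF _ measurable_ennreal] borel_measurable_peak measurable_iid_component) auto
  qed
  also have "\<dots> \<le> (\<Sum>i\<in>N. \<integral>\<^sup>+x. indicator (wins N g r i) x * ennreal (peak (U i) x) \<partial>PiM N (\<lambda>_. D))"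
  proof (intro sum_mono nn_integral_wins_top_set)
    fix i assume i: "i \<in> N"
    show "T i \<subseteq> N - {i}" using K K1 by (auto simp: T_def)
    have "i \<in> K1" if "i \<in> K" using that by (simp add: K1_def)
    then have "card (T i) = k" using K(2) K1(2) by (simp add: T_def card_Diff_singleton)
    then show "card (T i) \<le> card (U i)" using U(2)[OF i] by simp
    fix a b assume ab: "a \<in> T i" "b \<in> N - {i} - T i"
    show "lex_better g r a b"
    proof (cases "a = c")
      case True
      then show ?thesis using ab c cb[of b] by (auto simp: T_def K1_def split: if_splits)
    next
      case False
      then show ?thesis using ab K(3)[of a b] by (auto simp: T_def K1_def split: if_splits)
    qed
  qed (use U in auto)
  finally show ?thesis .
qed

text \<open>Every point has exactly one winner, so the sum over potential winners collapses to the
  single term that \<open>f\<close> dominates.\<close>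

lemma nn_integral_runner_up_le_winner_price:
  assumes r: "inj_on r N" and U: "\<And>i. i \<in> N \<Longrightarrow> U i \<subseteq> N - {i}" "\<And>i. i \<in> N \<Longrightarrow> k \<le> card (U i)"
    and K0: "K0 \<subseteq> N" "card K0 = Suc k"
    and f: "\<And>i x. i \<in> N \<Longrightarrow> x \<in> wins N g r i \<Longrightarrow> ennreal (peak (U i) x) \<le> f x"
  shows "(\<integral>\<^sup>+x. ennreal (runner_up K0 x) \<partial>PiM N (\<lambda>_. D)) \<le> (\<integral>\<^sup>+x. f x \<partial>PiM N (\<lambda>_. D))"
proof -
  have ne: "N \<noteq> {}" using K0 by auto
  have "(\<integral>\<^sup>+x. ennreal (runner_up K0 x) \<partial>PiM N (\<lambda>_. D)) \<le>
    (\<Sum>i\<in>N. \<integral>\<^sup>+x. indicator (wins N g r i) x * ennreal (peak (U i) x) \<partial>PiM N (\<lambda>_. D))"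
    by (rule nn_integral_runner_up_le[OF r U K0])
  also have "\<dots> = (\<integral>\<^sup>+x. (\<Sum>i\<in>N. indicator (wins N g r i) x * ennreal (peak (U i) x)) \<partial>PiM N (\<lambda>_. D))"
  proof (rule nn_integral_sum[symmetric])
    fix i assume i: "i \<in> N"
    have "U i \<subseteq> N" "finite (U i)" using U(1)[OF i] N by (auto intro: finite_subset)
    then show "(\<lambda>x. indicator (wins N g r i) x * ennreal (peak (U i) x)) \<in> borel_measurable (PiM N (\<lambda>_. D))"
      using i by (intro borel_measurable_times_ennreal borel_measurable_indicator_wins
        measurable_compose[OF _ measurable_ennreal] borel_measurable_peak measurable_iid_component) auto
  qed
  also have "\<dots> \<le> (\<integral>\<^sup>+x. f x \<partial>PiM N (\<lambda>_. D))"
  proof (rule nn_integral_mono)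
    fix x
    obtain i where i: "i \<in> N" "x \<in> wins N g r i" using ex_wins[OF ne r] by blast
    have "c = i" if "c \<in> N" "x \<in> wins N g r c" for c
      using i that lex_better_asym[of "\<lambda>c. x c + g c" r i c] unfolding wins_def by auto
    then have "{c \<in> N. x \<in> wins N g r c} = {i}" using i by blast
    then have "(\<Sum>c\<in>N. indicator (wins N g r c) x * ennreal (peak (U c) x)) = ennreal (peak (U i) x)"
      using N by simp
    then show "(\<Sum>c\<in>N. indicator (wins N g r c) x * ennreal (peak (U c) x)) \<le> f x"
      using f[OF i] by simp
  qed
  finally show ?thesis .
qed

end

subsection \<open>Independent allocations\<close>

text \<open>Only independent bundles are handed out, so that welfare becomes linear in the values:
  the maximum inside a constrained valuation is absorbed into the choice of the allocation.\<close>

definition indep_allocs :: "'i set set \<Rightarrow> 'b set \<Rightarrow> 'i set \<Rightarrow> ('b \<Rightarrow> 'i set) set" where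
  "indep_allocs \<I> N S = {A \<in> N \<rightarrow>\<^sub>E \<I>. disjoint_family_on A N \<and> (\<forall>i\<in>N. A i \<subseteq> S)}"

definition alloc_weight :: "('b \<times> 'i \<Rightarrow> real) \<Rightarrow> 'b set \<Rightarrow> ('b \<Rightarrow> 'i set) \<Rightarrow> real" where
  "alloc_weight x N A = (\<Sum>i\<in>N. \<Sum>l\<in>A i. x (i, l))"

definition opt_weight :: "'i set set \<Rightarrow> ('b \<times> 'i \<Rightarrow> real) \<Rightarrow> 'b set \<Rightarrow> 'i set \<Rightarrow> real" where
  "opt_weight \<I> x N S = Max (alloc_weight x N ` indep_allocs \<I> N S)"

text \<open>Every item other than a loop must be sold. Each item to be priced then has a winner,
  even where an optimal allocation could leave it unsold because nobody has a positive value for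
  it.\<close>

definition full_allocs :: "'i set set \<Rightarrow> 'b set \<Rightarrow> 'i set \<Rightarrow> ('b \<Rightarrow> 'i set) set" where
  "full_allocs \<I> N S = {A \<in> indep_allocs \<I> N S. \<forall>j\<in>S. {j} \<in> \<I> \<longrightarrow> (\<exists>i\<in>N. j \<in> A i)}"

text \<open>
  The part of the externality of a bidder holding \<open>T\<close> that is attributed to \<open>j \<in> T\<close> when the
  items of \<open>T\<close> are handed to the bidders \<open>N\<close> one after the other.
\<close>

definition gain ::
  "'i set \<Rightarrow> 'i set set \<Rightarrow> ('b \<times> 'i::linorder \<Rightarrow> real) \<Rightarrow> 'b set \<Rightarrow> 'i set \<Rightarrow> 'i \<Rightarrow> real" where
  "gain E \<I> x N T j =
     opt_weight \<I> x N ((E - T) \<union> {l\<in>T. l \<le> j}) - opt_weight \<I> x N ((E - T) \<union> {l\<in>T. l < j})"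

lemma alloc_weight_cong:
  "(\<And>i l. i \<in> N \<Longrightarrow> l \<in> A i \<Longrightarrow> x (i, l) = y (i, l)) \<Longrightarrow> alloc_weight x N A = alloc_weight y N A"
  unfolding alloc_weight_def by (intro sum.cong refl) auto

lemma alloc_weight_cong_alloc:
  "(\<And>i. i \<in> N \<Longrightarrow> A i = B i) \<Longrightarrow> alloc_weight x N A = alloc_weight x N B"
  unfolding alloc_weight_def by (intro sum.cong refl) auto

context
  fixes E :: "'i set" and \<I> :: "'i set set" and N :: "'b set"
  assumes E: "finite E" and \<I>: "\<I> \<subseteq> Pow E" "{} \<in> \<I>" and N: "finite N"
begin

lemma finite_indep: "T \<in> \<I> \<Longrightarrow> finite T"
  using E \<I>(1) by (meson PowD finite_subset subsetD)

lemma finite_indep_allocs: "finite (indep_allocs \<I> N S)"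
proof (rule finite_subset)
  show "indep_allocs \<I> N S \<subseteq> N \<rightarrow>\<^sub>E \<I>" by (auto simp: indep_allocs_def)
  show "finite (N \<rightarrow>\<^sub>E \<I>)" using N E \<I>(1) by (intro finite_PiE) (auto intro: finite_subset)
qed

lemma empty_alloc: "(\<lambda>i\<in>N. {}) \<in> indep_allocs \<I> N S"
  using \<I>(2) by (auto simp: indep_allocs_def disjoint_family_on_def)

lemma opt_weight_ge: "A \<in> indep_allocs \<I> N S \<Longrightarrow> alloc_weight x N A \<le> opt_weight \<I> x N S"
  unfolding opt_weight_def using finite_indep_allocs by (intro Max_ge) auto

lemma opt_weight_attained: "\<exists>A\<in>indep_allocs \<I> N S. alloc_weight x N A = opt_weight \<I> x N S"
proof -
  have "opt_weight \<I> x N S \<in> alloc_weight x N ` indep_allocs \<I> N S"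
    unfolding opt_weight_def using finite_indep_allocs empty_alloc by (intro Max_in) auto
  then show ?thesis by auto
qed

lemma opt_weight_le:
  "(\<And>A. A \<in> indep_allocs \<I> N S \<Longrightarrow> alloc_weight x N A \<le> c) \<Longrightarrow> opt_weight \<I> x N S \<le> c"
  using opt_weight_attained[of S x] by fastforce

lemma indep_allocs_mono: "S \<subseteq> S' \<Longrightarrow> indep_allocs \<I> N S \<subseteq> indep_allocs \<I> N S'"
  by (auto simp: indep_allocs_def)

lemma opt_weight_mono: "S \<subseteq> S' \<Longrightarrow> opt_weight \<I> x N S \<le> opt_weight \<I> x N S'"
  using indep_allocs_mono[of S S'] by (intro opt_weight_le opt_weight_ge) auto

lemma alloc_insert:
  assumes A: "A \<in> indep_allocs \<I> N S" and i: "i \<in> N" "insert j (A i) \<in> \<I>" and j: "\<And>i. i \<in> N \<Longrightarrow> j \<notin> A i"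
  shows "A(i := insert j (A i)) \<in> indep_allocs \<I> N (insert j S)"
    and "alloc_weight x N (A(i := insert j (A i))) = alloc_weight x N A + x (i, j)"
proof -
  show "A(i := insert j (A i)) \<in> indep_allocs \<I> N (insert j S)"
    using A i j by (auto simp: indep_allocs_def disjoint_family_on_def PiE_iff extensional_def)
  have "finite (A i)" using A i by (intro finite_indep) (auto simp: indep_allocs_def PiE_iff)
  then show "alloc_weight x N (A(i := insert j (A i))) = alloc_weight x N A + x (i, j)"
    using i j[of i] N unfolding alloc_weight_def by (simp add: sum.remove[of N i])
qed

text \<open>Any bidder whose bundle stays independent with \<open>j\<close> can simply be given
  \<open>j\<close> on top of an optimal allocation of \<open>S\<close>. The \<open>0\<close> inside
  \<open>peak\<close> is covered by monotonicity in the item set.\<close>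

lemma peak_le_marginal:
  assumes A: "A \<in> indep_allocs \<I> N S" "alloc_weight x N A = opt_weight \<I> x N S" and j: "j \<notin> S"
  shows "peak {i \<in> N. insert j (A i) \<in> \<I>} (\<lambda>i. x (i, j)) \<le>
    opt_weight \<I> x N (insert j S) - opt_weight \<I> x N S"
proof (rule peak_le)
  show "0 \<le> opt_weight \<I> x N (insert j S) - opt_weight \<I> x N S"
    using opt_weight_mono[of S "insert j S" x] by auto
  fix i assume "i \<in> {i \<in> N. insert j (A i) \<in> \<I>}"
  then have i: "i \<in> N" "insert j (A i) \<in> \<I>" by auto
  have "\<And>i. i \<in> N \<Longrightarrow> j \<notin> A i" using A(1) j by (auto simp: indep_allocs_def)
  from alloc_insert[OF A(1) i this] show "x (i, j) \<le> opt_weight \<I> x N (insert j S) - opt_weight \<I> x N S"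
    using opt_weight_ge[of "A(i := insert j (A i))" "insert j S" x] A(2) by auto
qed (use N in auto)

lemma alloc_weight_remove:
  assumes "A \<in> indep_allocs \<I> N S"
  shows "alloc_weight x (N - {i}) A = alloc_weight x N A - (if i \<in> N then \<Sum>l\<in>A i. x (i, l) else 0)"
  using N unfolding alloc_weight_def by (auto simp: sum.remove[of N i])

end

text \<open>The sum telescopes in increasing order of the items: adding a new largest item leaves
  the earlier summands as they were.\<close>

lemma sum_gain:
  fixes T :: "'i::linorder set" and N :: "'b set"
  assumes "finite T"
  shows "(\<Sum>j\<in>T. opt_weight \<I> x N (S \<union> {l\<in>T. l \<le> j}) - opt_weight \<I> x N (S \<union> {l\<in>T. l < j})) =
    opt_weight \<I> x N (S \<union> T) - opt_weight \<I> x N S"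
  using assms
proof (induction T rule: finite_linorder_max_induct)
  case empty
  then show ?case by simp
next
  case (insert b T)
  have b: "b \<notin> T" using insert by auto
  have "{l \<in> insert b T. l \<le> j} = {l \<in> T. l \<le> j}" "{l \<in> insert b T. l < j} = {l \<in> T. l < j}"
    if "j \<in> T" for j
    using insert(2) that by (auto dest: leD less_trans)
  moreover have "{l \<in> insert b T. l \<le> b} = insert b T" "{l \<in> insert b T. l < b} = T"
    using insert(2) by auto
  ultimately show ?case using insert b by simp
qed

context
  fixes E :: "'i::linorder set" and \<I> :: "'i set set" and N :: "'b set"
  assumes E: "finite E" and \<I>: "\<I> \<subseteq> Pow E" "{} \<in> \<I>" and N: "finite N"
begin

lemma gain_nonneg: "0 \<le> gain E \<I> x N T j"
proof -
  have "(E - T) \<union> {l\<in>T. l < j} \<subseteq> (E - T) \<union> {l\<in>T. l \<le> j}" by auto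
  from opt_weight_mono[OF E \<I> N this, of x] show ?thesis by (simp add: gain_def)
qed

text \<open>The others hold items of \<open>E - A i\<close> only, so their weight under
  \<open>A\<close> is at most the optimum for \<open>E - A i\<close>. From there to the optimum for
  \<open>E\<close> the gains telescope.\<close>

lemma sum_gain_le_externality:
  assumes A: "A \<in> indep_allocs \<I> N E" and i: "i \<in> N"
  shows "(\<Sum>j\<in>A i. gain E \<I> x (N - {i}) (A i) j) \<le>
    opt_weight \<I> x (N - {i}) E - alloc_weight x (N - {i}) A"
proof -
  have Ai: "A i \<in> \<I>" using A i by (auto simp: indep_allocs_def PiE_iff)
  then have "A i \<subseteq> E" "finite (A i)" using \<I> E by (auto intro: finite_subset)
  have N': "finite (N - {i})" using N by simp
  have "restrict A (N - {i}) \<in> indep_allocs \<I> (N - {i}) (E - A i)"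
    using A i by (fastforce simp: indep_allocs_def PiE_iff disjoint_family_on_def)
  from opt_weight_ge[OF E \<I> N' this, of x]
  have "alloc_weight x (N - {i}) A \<le> opt_weight \<I> x (N - {i}) (E - A i)"
    using alloc_weight_cong_alloc[of "N - {i}" "restrict A (N - {i})" A x] by simp
  moreover have "E - A i \<union> A i = E" using \<open>A i \<subseteq> E\<close> by auto
  ultimately show ?thesis
    using sum_gain[OF \<open>finite (A i)\<close>, of \<I> x "N - {i}" "E - A i"] unfolding gain_def by simp
qed

end

section \<open>Spanned bundles and full allocations\<close>

lemma card_spanning_le:
  assumes mat: "matroid E \<I>" and A: "A \<in> indep_allocs \<I> N S" and N: "finite N"
    and j: "j \<in> E" "{j} \<in> \<I>" "\<And>i. i \<in> N \<Longrightarrow> j \<notin> A i"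
  shows "card {i \<in> N. insert j (A i) \<notin> \<I>} \<le> disjoint_spanning_number E \<I>"
proof -
  define B where "B = {i \<in> N. insert j (A i) \<notin> \<I>}"
  have E: "finite E" and \<I>: "\<I> \<subseteq> Pow E" "{} \<in> \<I>"
    and down: "\<And>B A. B \<in> \<I> \<Longrightarrow> A \<subseteq> B \<Longrightarrow> A \<in> \<I>" using mat by (auto simp: matroid_def)
  have finI: "finite \<I>" using E \<I>(1) by (auto intro: finite_subset)
  have AI: "A i \<in> \<I>" if "i \<in> N" for i using A that by (auto simp: indep_allocs_def PiE_iff)
  have dis: "disjoint_family_on A N" using A by (auto simp: indep_allocs_def)
  \<comment> \<open>The assumption that \<open>j\<close> is not a loop is crucial here. Disjoint
    nonempty bundles are distinct, so counting bidders is the same as counting the sets of the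
    spanning collection; several bidders with an empty bundle would contribute only one set.\<close>
  have ne: "A i \<noteq> {}" if "i \<in> B" for i using that j(2) by (auto simp: B_def)
  have inj: "inj_on A B"
  proof (rule inj_onI)
    fix i i' assume i: "i \<in> B" "i' \<in> B" "A i = A i'"
    show "i = i'"
    proof (rule ccontr)
      assume "i \<noteq> i'"
      then have "A i \<inter> A i' = {}" using dis i by (auto simp: disjoint_family_on_def B_def)
      then show False using i ne by auto
    qed
  qed
  have sp: "spans \<I> (A i) j" if i: "i \<in> B" for i
  proof -
    have iN: "i \<in> N" and nI: "insert j (A i) \<notin> \<I>" using i by (auto simp: B_def)
    have fin: "finite (A i)" using AI[OF iN] \<I>(1) E by (auto intro: finite_subset)
    have fin': "finite {T \<in> \<I>. T \<subseteq> S}" for S using finI by simp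
    have r1: "matroid_rank \<I> (A i) = card (A i)"
      unfolding matroid_rank_def
      using AI[OF iN] fin fin' by (intro Max_eqI) (auto intro: card_mono)
    have r2: "matroid_rank \<I> (insert j (A i)) = card (A i)"
      unfolding matroid_rank_def
    proof (rule Max_eqI)
      fix y assume "y \<in> card ` {T \<in> \<I>. T \<subseteq> insert j (A i)}"
      then obtain T where T: "T \<in> \<I>" "T \<subseteq> insert j (A i)" "y = card T" by auto
      then have "T \<subset> insert j (A i)" using nI by auto
      from psubset_card_mono[OF _ this] show "y \<le> card (A i)"
        using fin T j(3)[OF iN] by simp
    qed (use fin' AI[OF iN] in auto)
    show ?thesis using r1 r2 j(3)[OF iN] by (simp add: spans_def)
  qed
  have "disjoint_spanning_collection \<I> j (A ` B)"
    unfolding disjoint_spanning_collection_def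
  proof (intro conjI ballI)
    show "A ` B \<subseteq> \<I>" using AI by (auto simp: B_def)
    show "disjoint (A ` B)"
      unfolding disjoint_def
    proof (intro ballI impI)
      fix S S' assume "S \<in> A ` B" "S' \<in> A ` B" "S \<noteq> S'"
      then obtain i i' where "i \<in> N" "i' \<in> N" "i \<noteq> i'" "S = A i" "S' = A i'" by (auto simp: B_def)
      then show "S \<inter> S' = {}" using dis by (auto simp: disjoint_family_on_def)
    qed
    fix S assume "S \<in> A ` B"
    then show "j \<notin> S" "spans \<I> S j" using sp j(3) by (auto simp: B_def)
  qed
  moreover have "finite {\<C>. disjoint_spanning_collection \<I> j \<C>}"
    by (rule finite_subset[of _ "Pow \<I>"]) (auto simp: disjoint_spanning_collection_def finI)
  ultimately have "card (A ` B) \<le> disjoint_spanning_number_at \<I> j"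
    unfolding disjoint_spanning_number_at_def by (intro Max_ge) auto
  also have "\<dots> \<le> disjoint_spanning_number E \<I>"
    unfolding disjoint_spanning_number_def using E j(1) by (intro Max_ge) auto
  finally show ?thesis using inj by (simp add: card_image B_def)
qed

text \<open>An unsold item that is not a loop is spanned by at most \<rho> bundles. With more than
  \<rho> bidders someone can take it, and the number of unsold items drops.\<close>

lemma full_alloc_extends:
  assumes mat: "matroid E \<I>" and A: "A \<in> indep_allocs \<I> N E" and N: "finite N"
    and card: "disjoint_spanning_number E \<I> < card N"
  shows "\<exists>A'\<in>full_allocs \<I> N E. \<forall>i\<in>N. A i \<subseteq> A' i"
  using A
proof (induction "card (E - (\<Union>i\<in>N. A i))" arbitrary: A rule: less_induct)
  case less
  have E: "finite E" and \<I>: "\<I> \<subseteq> Pow E" "{} \<in> \<I>" using mat by (auto simp: matroid_def)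
  show ?case
  proof (cases "A \<in> full_allocs \<I> N E")
    case False
    then obtain j where j: "j \<in> E" "{j} \<in> \<I>" "\<And>i. i \<in> N \<Longrightarrow> j \<notin> A i"
      using less.prems by (auto simp: full_allocs_def)
    have "card {i \<in> N. insert j (A i) \<notin> \<I>} < card N"
      using card_spanning_le[OF mat less.prems N j] card by simp
    then have "{i \<in> N. insert j (A i) \<notin> \<I>} \<noteq> N" by auto
    then obtain i where i: "i \<in> N" "insert j (A i) \<in> \<I>" by auto
    let ?A = "A(i := insert j (A i))"
    have A': "?A \<in> indep_allocs \<I> N E"
      using alloc_insert(1)[OF E \<I> N less.prems i j(3)] j(1) by (simp add: insert_absorb)
    have "E - (\<Union>i\<in>N. ?A i) \<subset> E - (\<Union>i\<in>N. A i)"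
    proof
      show "E - (\<Union>i\<in>N. ?A i) \<subseteq> E - (\<Union>i\<in>N. A i)" using i by (auto split: if_splits)
      have "j \<in> E - (\<Union>i\<in>N. A i)" "j \<notin> E - (\<Union>i\<in>N. ?A i)" using j i by auto
      then show "E - (\<Union>i\<in>N. ?A i) \<noteq> E - (\<Union>i\<in>N. A i)" by blast
    qed
    then have "card (E - (\<Union>i\<in>N. ?A i)) < card (E - (\<Union>i\<in>N. A i))"
      using E by (intro psubset_card_mono) auto
    from less.hyps[OF this A'] obtain A' where "A' \<in> full_allocs \<I> N E" "\<forall>i\<in>N. ?A i \<subseteq> A' i" by blast
    then show ?thesis using i by (intro bexI[of _ A']) (auto split: if_splits)
  qed auto
qed

text \<open>With non-negative values, extending an optimal allocation to a full one loses
  nothing.\<close>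

lemma full_alloc_optimal:
  assumes mat: "matroid E \<I>" and N: "finite N" and card: "disjoint_spanning_number E \<I> < card N"
    and x: "\<And>i l. i \<in> N \<Longrightarrow> l \<in> E \<Longrightarrow> 0 \<le> x (i, l)"
  shows "\<exists>A\<in>full_allocs \<I> N E. alloc_weight x N A = opt_weight \<I> x N E"
proof -
  have E: "finite E" and \<I>: "\<I> \<subseteq> Pow E" "{} \<in> \<I>" using mat by (auto simp: matroid_def)
  obtain A where A: "A \<in> indep_allocs \<I> N E" "alloc_weight x N A = opt_weight \<I> x N E"
    using opt_weight_attained[OF E \<I> N] by blast
  obtain A' where A': "A' \<in> full_allocs \<I> N E" "\<forall>i\<in>N. A i \<subseteq> A' i"
    using full_alloc_extends[OF mat A(1) N card] by blast
  have iA': "A' \<in> indep_allocs \<I> N E" using A' by (auto simp: full_allocs_def)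
  have "alloc_weight x N A \<le> alloc_weight x N A'"
    unfolding alloc_weight_def
  proof (intro sum_mono sum_mono2)
    fix i assume i: "i \<in> N"
    have "A' i \<in> \<I>" using iA' i by (auto simp: indep_allocs_def PiE_iff)
    then have sub: "A' i \<subseteq> E" using \<I> by auto
    then show "finite (A' i)" using E by (rule finite_subset)
    show "A i \<subseteq> A' i" using A' i by auto
    fix l assume "l \<in> A' i - A i"
    then show "0 \<le> x (i, l)" using x sub i by auto
  qed
  with opt_weight_ge[OF E \<I> N iA', of x] A(2) A'(1) show ?thesis by (intro bexI[of _ A']) auto
qed

text \<open>
  The right-hand side is the sum of the externalities at any optimal allocation, so it can be
  bounded with the help of a convenient one.
\<close>

lemma sum_gain_le_payments:
  assumes mat: "matroid E \<I>" and N: "finite N"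
    and A: "A \<in> indep_allocs \<I> N E" "alloc_weight x N A = opt_weight \<I> x N E"
  shows "(\<Sum>i\<in>N. \<Sum>j\<in>A i. gain E \<I> x (N - {i}) (A i) j) \<le>
    (\<Sum>i\<in>N. opt_weight \<I> x (N - {i}) E) - (real (card N) - 1) * opt_weight \<I> x N E"
proof -
  have E: "finite E" and \<I>: "\<I> \<subseteq> Pow E" "{} \<in> \<I>" using mat by (auto simp: matroid_def)
  have "(\<Sum>i\<in>N. alloc_weight x (N - {i}) A) = (\<Sum>i\<in>N. alloc_weight x N A - (\<Sum>l\<in>A i. x (i, l)))"
    using alloc_weight_remove[OF E \<I> N A(1)] by (intro sum.cong) auto
  also have "\<dots> = (real (card N) - 1) * opt_weight \<I> x N E"
    by (simp add: sum_subtractf A(2)[unfolded alloc_weight_def] alloc_weight_def algebra_simps)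
  finally have "(\<Sum>i\<in>N. opt_weight \<I> x (N - {i}) E) - (real (card N) - 1) * opt_weight \<I> x N E =
    (\<Sum>i\<in>N. opt_weight \<I> x (N - {i}) E - alloc_weight x (N - {i}) A)"
    by (simp add: sum_subtractf)
  then show ?thesis
    using sum_gain_le_externality[OF E \<I> N A(1)] by (simp add: sum_mono)
qed

section \<open>Welfare and VCG payments as optimal weights\<close>

lemma constrained_valuation_ge:
  assumes "finite \<I>" "T \<in> \<I>" "T \<subseteq> S" "S \<subseteq> {..<m}"
  shows "(\<Sum>j\<in>T. x j) \<le> constrained_valuation m \<I> x S"
  unfolding constrained_valuation_def using assms by (auto intro!: Max_ge)

lemma constrained_valuation_attained:
  assumes "finite \<I>" "{} \<in> \<I>" "S \<subseteq> {..<m}"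
  shows "\<exists>T\<in>\<I>. T \<subseteq> S \<and> constrained_valuation m \<I> x S = (\<Sum>j\<in>T. x j)"
proof -
  have "Max ((\<lambda>T. \<Sum>j\<in>T. x j) ` {T \<in> \<I>. T \<subseteq> S}) \<in> (\<lambda>T. \<Sum>j\<in>T. x j) ` {T \<in> \<I>. T \<subseteq> S}"
    using assms by (intro Max_in) auto
  then show ?thesis using assms(3) unfolding constrained_valuation_def by auto
qed

lemma finite_allocations: "finite N \<Longrightarrow> finite (allocations m N)"
  unfolding allocations_def by (rule finite_subset[of _ "N \<rightarrow>\<^sub>E Pow {..<m}"]) (auto intro: finite_PiE)

lemma allocations_ne: "allocations m N \<noteq> {}"
proof -
  have "(\<lambda>i\<in>N. {}) \<in> allocations m N" by (auto simp: allocations_def disjoint_family_on_def)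
  then show ?thesis by auto
qed

lemma max_welfare_ge: "finite N \<Longrightarrow> A \<in> allocations m N \<Longrightarrow> welfare N b A \<le> max_welfare m N b"
  unfolding max_welfare_def using finite_allocations by (intro Max_ge) auto

lemma welfare_vcg_alloc:
  "vcg_alloc m k b \<in> allocations m {..<k}"
  "welfare {..<k} b (vcg_alloc m k b) = max_welfare m {..<k} b"
proof -
  have fin: "finite (allocations m {..<k})" by (rule finite_allocations) simp
  have "Max (welfare {..<k} b ` allocations m {..<k}) \<in> welfare {..<k} b ` allocations m {..<k}"
    using fin allocations_ne by (intro Max_in) auto
  then obtain A0 where "A0 \<in> allocations m {..<k}"
      "welfare {..<k} b A0 = Max (welfare {..<k} b ` allocations m {..<k})" by auto
  then have "is_arg_max (welfare {..<k} b) (\<lambda>A. A \<in> allocations m {..<k}) A0"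
    using fin by (simp add: is_arg_max_linorder)
  then have "\<exists>A. is_arg_max (welfare {..<k} b) (\<lambda>A. A \<in> allocations m {..<k}) A" by blast
  then have am: "is_arg_max (welfare {..<k} b) (\<lambda>A. A \<in> allocations m {..<k}) (vcg_alloc m k b)"
    unfolding vcg_alloc_def arg_max_on_def arg_max_def by (rule someI_ex)
  then show A: "vcg_alloc m k b \<in> allocations m {..<k}" by (simp add: is_arg_max_def)
  have "welfare {..<k} b (vcg_alloc m k b) = Max (welfare {..<k} b ` allocations m {..<k})"
    using am A fin unfolding is_arg_max_linorder by (intro Max_eqI[symmetric]) auto
  then show "welfare {..<k} b (vcg_alloc m k b) = max_welfare m {..<k} b"
    unfolding max_welfare_def .
qed

lemma vcg_pay_nonneg: "0 \<le> vcg_pay m k b i"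
proof -
  have "restrict (vcg_alloc m k b) ({..<k} - {i}) \<in> allocations m ({..<k} - {i})"
    using welfare_vcg_alloc(1)[of m k b]
    by (auto simp: allocations_def PiE_iff disjoint_family_on_def)
  from max_welfare_ge[OF _ this, of b]
  have "welfare ({..<k} - {i}) b (restrict (vcg_alloc m k b) ({..<k} - {i})) \<le> max_welfare m ({..<k} - {i}) b"
    by simp
  moreover have "welfare ({..<k} - {i}) b (restrict (vcg_alloc m k b) ({..<k} - {i})) =
      welfare ({..<k} - {i}) b (vcg_alloc m k b)"
    unfolding welfare_def by (intro sum.cong) auto
  ultimately show ?thesis by (simp add: vcg_pay_def)
qed

text \<open>The right-hand side contains maxima only. This removes the tie-breaking by choice, and
  with it any question about the measurability of \<open>vcg_alloc\<close>, from the
  revenue.\<close>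

lemma sum_vcg_pay:
  "(\<Sum>i<k. vcg_pay m k b i) =
    (\<Sum>i<k. max_welfare m ({..<k} - {i}) b) - (real k - 1) * max_welfare m {..<k} b"
proof -
  let ?A = "vcg_alloc m k b"
  have "(\<Sum>i<k. welfare ({..<k} - {i}) b ?A) = (\<Sum>i<k. max_welfare m {..<k} b - b i (?A i))"
    unfolding welfare_vcg_alloc(2)[symmetric] welfare_def by (intro sum.cong refl) (simp add: sum.remove)
  also have "\<dots> = (real k - 1) * max_welfare m {..<k} b"
    using welfare_vcg_alloc(2)[of k b m] by (simp add: sum_subtractf welfare_def algebra_simps)
  finally show ?thesis by (simp add: vcg_pay_def sum_subtractf)
qed

text \<open>Shrinking each bundle to its best independent part keeps the bundles disjoint and the
  welfare unchanged. Conversely, a bidder values an independent bundle at no less than the sum of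
  its items.\<close>

lemma max_welfare_constrained:
  assumes \<I>: "\<I> \<subseteq> Pow {..<m}" "{} \<in> \<I>" and N: "finite N"
    and b: "\<And>i. i \<in> N \<Longrightarrow> b i = constrained_valuation m \<I> (\<lambda>l. x (i, l))"
  shows "max_welfare m N b = opt_weight \<I> x N {..<m}"
proof (rule antisym)
  have fI: "finite \<I>" using \<I>(1) by (rule finite_subset) simp
  show "max_welfare m N b \<le> opt_weight \<I> x N {..<m}"
    unfolding max_welfare_def
  proof (rule Max.boundedI)
    fix y assume "y \<in> welfare N b ` allocations m N"
    then obtain A where A: "A \<in> allocations m N" "y = welfare N b A" by auto
    then have sub: "A i \<subseteq> {..<m}" if "i \<in> N" for i using that by (auto simp: allocations_def PiE_iff)
    have "\<exists>T. \<forall>i\<in>N. T i \<in> \<I> \<and> T i \<subseteq> A i \<and> b i (A i) = (\<Sum>j\<in>T i. x (i, j))"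
      using constrained_valuation_attained[OF fI \<I>(2) sub] b by (intro bchoice) metis
    then obtain T where T: "\<And>i. i \<in> N \<Longrightarrow> T i \<in> \<I> \<and> T i \<subseteq> A i \<and> b i (A i) = (\<Sum>j\<in>T i. x (i, j))"
      by blast
    have "T i \<inter> T i' = {}" if "i \<in> N" "i' \<in> N" "i \<noteq> i'" for i i'
    proof -
      have "A i \<inter> A i' = {}" using A(1) that by (auto simp: allocations_def disjoint_family_on_def)
      then show ?thesis using T that by blast
    qed
    then have dis: "disjoint_family_on (restrict T N) N" by (simp add: disjoint_family_on_def)
    have "T i \<subseteq> {..<m}" if "i \<in> N" for i using T[OF that] sub[OF that] by blast
    with dis have "restrict T N \<in> indep_allocs \<I> N {..<m}"
      using T by (auto simp: indep_allocs_def)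
    from opt_weight_ge[OF _ \<I> N this, of x]
    have "alloc_weight x N (restrict T N) \<le> opt_weight \<I> x N {..<m}" by simp
    moreover have "alloc_weight x N (restrict T N) = y"
      unfolding A(2) alloc_weight_def welfare_def using T by (intro sum.cong) auto
    ultimately show "y \<le> opt_weight \<I> x N {..<m}" by simp
  qed (use allocations_ne finite_allocations[OF N] in auto)
  show "opt_weight \<I> x N {..<m} \<le> max_welfare m N b"
  proof (rule opt_weight_le[OF _ \<I> N])
    fix A assume A: "A \<in> indep_allocs \<I> N {..<m}"
    then have A': "A \<in> allocations m N" using \<I>(1) by (auto simp: indep_allocs_def allocations_def PiE_iff)
    have "alloc_weight x N A \<le> welfare N b A"
      unfolding alloc_weight_def welfare_def
    proof (rule sum_mono)
      fix i assume i: "i \<in> N"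
      have "A i \<in> \<I>" using A i by (auto simp: indep_allocs_def PiE_iff)
      then show "(\<Sum>l\<in>A i. x (i, l)) \<le> b i (A i)"
        unfolding b[OF i] using \<I>(1) fI by (intro constrained_valuation_ge) auto
    qed
    also have "\<dots> \<le> max_welfare m N b" by (rule max_welfare_ge[OF N A'])
    finally show "alloc_weight x N A \<le> max_welfare m N b" .
  qed simp
qed

lemma opt_weight_additive:
  assumes N: "finite N" and m: "finite E"
  shows "opt_weight (Pow E) x N E = (\<Sum>j\<in>E. peak N (\<lambda>i. x (i, j)))"
proof (rule antisym)
  show "opt_weight (Pow E) x N E \<le> (\<Sum>j\<in>E. peak N (\<lambda>i. x (i, j)))"
  proof (rule opt_weight_le[OF m _ _ N])
    fix A assume A: "A \<in> indep_allocs (Pow E) N E"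
    then have sub: "A i \<subseteq> E" and dis: "disjoint_family_on A N" if "i \<in> N" for i
      using that by (auto simp: indep_allocs_def)
    have "alloc_weight x N A \<le> (\<Sum>i\<in>N. \<Sum>j\<in>A i. peak N (\<lambda>i. x (i, j)))"
      unfolding alloc_weight_def using peak_ge[OF N] by (intro sum_mono) fastforce
    also have "\<dots> = (\<Sum>j\<in>(\<Union>i\<in>N. A i). peak N (\<lambda>i. x (i, j)))"
      using N sub dis m by (intro sum.UNION_disjoint[symmetric]) (auto simp: disjoint_family_on_def intro: finite_subset)
    also have "\<dots> \<le> (\<Sum>j\<in>E. peak N (\<lambda>i. x (i, j)))"
      using sub m peak_nonneg[OF N] by (intro sum_mono2) auto
    finally show "alloc_weight x N A \<le> (\<Sum>j\<in>E. peak N (\<lambda>i. x (i, j)))" .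
  qed auto
  \<comment> \<open>An item is \<open>good\<close> if some bidder attains its peak. Otherwise the
    peak is the inserted \<open>0\<close>, and the item is left unsold.\<close>
  define good where "good j = (\<exists>i\<in>N. x (i, j) = peak N (\<lambda>i. x (i, j)))" for j
  define h where "h j = (SOME i. i \<in> N \<and> x (i, j) = peak N (\<lambda>i. x (i, j)))" for j
  have h: "h j \<in> N" "x (h j, j) = peak N (\<lambda>i. x (i, j))" if "good j" for j
    using someI_ex[of "\<lambda>i. i \<in> N \<and> x (i, j) = peak N (\<lambda>i. x (i, j))"] that by (auto simp: h_def good_def)
  have bad: "peak N (\<lambda>i. x (i, j)) = 0" if "\<not> good j" for j
  proof -
    have "peak N (\<lambda>i. x (i, j)) \<in> insert 0 ((\<lambda>i. x (i, j)) ` N)"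
      unfolding peak_def using N by (intro Max_in) auto
    with that show ?thesis by (auto simp: good_def)
  qed
  define A where "A = (\<lambda>i\<in>N. {j\<in>E. good j \<and> h j = i})"
  have A: "A \<in> indep_allocs (Pow E) N E"
    by (auto simp: A_def indep_allocs_def disjoint_family_on_def)
  have "(\<Sum>j\<in>E. peak N (\<lambda>i. x (i, j))) = (\<Sum>j\<in>{j\<in>E. good j}. x (h j, j))"
    using bad h(2) m by (intro sum.mono_neutral_cong_right) auto
  also have "\<dots> = (\<Sum>i\<in>N. \<Sum>j\<in>{j\<in>{j\<in>E. good j}. h j = i}. x (h j, j))"
    using N m h(1) by (intro sum.group[symmetric]) auto
  also have "\<dots> = alloc_weight x N A"
    unfolding alloc_weight_def A_def by (intro sum.cong) auto
  also have "\<dots> \<le> opt_weight (Pow E) x N E"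
    using opt_weight_ge[OF m _ _ N A] by auto
  finally show "(\<Sum>j\<in>E. peak N (\<lambda>i. x (i, j))) \<le> opt_weight (Pow E) x N E" .
qed

subsection \<open>A lower bound on the expected payments\<close>

context
  fixes E :: "nat set" and \<I> :: "nat set set" and N :: "nat set" and D :: "nat \<Rightarrow> real measure"
  assumes mat: "matroid E \<I>" and N: "finite N"
    and D: "\<And>j. prob_space (D j)" "\<And>j. sets (D j) = sets borel"
begin

text \<open>Indexing by pairs (bidder, item) makes all values one product measure, from which the
  values for a single item can be split off by Fubini's theorem.\<close>

abbreviation profiles :: "(nat \<times> nat \<Rightarrow> real) measure" where
  "profiles \<equiv> PiM (N \<times> E) (\<lambda>p. D (snd p))"

lemma indep_system: "finite E" "\<I> \<subseteq> Pow E" "{} \<in> \<I>"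
  using mat by (auto simp: matroid_def)

lemma measurable_profile_component [measurable (raw)]:
  "p \<in> N \<times> E \<Longrightarrow> (\<lambda>x. x p) \<in> borel_measurable profiles"
  using measurable_component_singleton[of p "N \<times> E" "\<lambda>p. D (snd p)"]
  by (simp add: D(2) cong: measurable_cong_sets)

lemma measurable_alloc_weight:
  assumes "N' \<subseteq> N" "A \<in> indep_allocs \<I> N' S"
  shows "(\<lambda>x. alloc_weight x N' A) \<in> borel_measurable profiles"
  unfolding alloc_weight_def
proof (intro borel_measurable_sum measurable_profile_component)
  fix i l assume "i \<in> N'" "l \<in> A i"
  moreover have "A i \<in> \<I>" using assms \<open>i \<in> N'\<close> by (auto simp: indep_allocs_def PiE_iff)
  ultimately show "(i, l) \<in> N \<times> E" using assms indep_system by auto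
qed

lemma measurable_opt_weight [measurable (raw)]:
  assumes "N' \<subseteq> N"
  shows "(\<lambda>x. opt_weight \<I> x N' S) \<in> borel_measurable profiles"
  unfolding opt_weight_def
  using assms N indep_system finite_indep_allocs[of E \<I> N' S]
  by (intro borel_measurable_Max measurable_alloc_weight) (auto intro: finite_subset)

definition full_rank :: "(nat \<Rightarrow> nat set) \<Rightarrow> nat" where
  "full_rank = to_nat_on (full_allocs \<I> N E)"

text \<open>A measurable stand-in for VCG's own allocation. It maximizes over full allocations only,
  which for non-negative values is no restriction once there are more than \<rho> bidders.\<close>

definition chosen :: "(nat \<times> nat \<Rightarrow> real) \<Rightarrow> nat \<Rightarrow> nat set" where
  "chosen x = lex_best (full_allocs \<I> N E) (alloc_weight x N) full_rank"

text \<open>The share of the total payment that is attributed to \<open>j\<close>. Bundles of an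
  allocation are disjoint, so at most one summand is nonzero; the sum avoids naming the
  winner.\<close>

definition item_gain :: "nat \<Rightarrow> (nat \<Rightarrow> nat set) \<Rightarrow> (nat \<times> nat \<Rightarrow> real) \<Rightarrow> real" where
  "item_gain j A x = (\<Sum>i\<in>N. if j \<in> A i then gain E \<I> x (N - {i}) (A i) j else 0)"

lemma item_gain_nonneg: "0 \<le> item_gain j A x"
  unfolding item_gain_def
proof (rule sum_nonneg)
  fix i
  have "finite (N - {i})" using N by simp
  from gain_nonneg[OF indep_system this]
  show "0 \<le> (if j \<in> A i then gain E \<I> x (N - {i}) (A i) j else 0)" by simp
qed

lemma finite_full_allocs: "finite (full_allocs \<I> N E)"
  using finite_indep_allocs[OF indep_system N] by (simp add: full_allocs_def)

lemma inj_full_rank: "inj_on full_rank (full_allocs \<I> N E)"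
  unfolding full_rank_def using finite_full_allocs by (intro inj_on_to_nat_on countable_finite)

context
  assumes many: "disjoint_spanning_number E \<I> < card N"
begin

text \<open>Extends the allocation that hands out nothing but \<open>j\<close>, to bidder
  \<open>i\<close>. Hence every bidder is a potential winner of \<open>j\<close> and has a
  well-defined handicap.\<close>

lemma full_alloc_with:
  assumes "i \<in> N" "j \<in> E" "{j} \<in> \<I>"
  shows "\<exists>A\<in>full_allocs \<I> N E. j \<in> A i"
proof -
  have "(\<lambda>c\<in>N. if c = i then {j} else {}) \<in> indep_allocs \<I> N E"
    using assms indep_system by (auto simp: indep_allocs_def disjoint_family_on_def)
  from full_alloc_extends[OF mat this N many] obtain A where
    A: "A \<in> full_allocs \<I> N E" "\<forall>c\<in>N. (\<lambda>c\<in>N. if c = i then {j} else {}) c \<subseteq> A c" by blast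
  from A(2)[THEN bspec, OF assms(1)] assms(1) have "j \<in> A i" by simp
  with A(1) show ?thesis by blast
qed

lemma full_allocs_ne: "full_allocs \<I> N E \<noteq> {}"
  using full_alloc_extends[OF mat empty_alloc[OF indep_system N] N many] by auto

lemma measurable_item_gain:
  "(\<lambda>x. item_gain j (chosen x) x) \<in> borel_measurable profiles"
proof (rule measurable_compose_countable'[where I = "full_allocs \<I> N E"])
  show "(\<lambda>x. chosen x) \<in> measurable profiles (count_space (full_allocs \<I> N E))"
    unfolding chosen_def
    by (intro measurable_lex_best finite_full_allocs full_allocs_ne inj_full_rank measurable_alloc_weight)
      (auto simp: full_allocs_def)
  show "(\<lambda>x. item_gain j A x) \<in> borel_measurable profiles" for A
    unfolding item_gain_def gain_def
    by (intro borel_measurable_sum borel_measurable_if borel_measurable_diff measurable_opt_weight)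
      auto
qed (use finite_full_allocs in \<open>auto intro: countable_finite\<close>)

text \<open>The chosen allocation is optimal, because some full allocation is. Its bundles contain
  no loops, so summing by item over the items that are not loops reaches all the gains that are
  summed by bidder.\<close>

lemma sum_item_gain_le_payments:
  assumes x: "\<And>i l. i \<in> N \<Longrightarrow> l \<in> E \<Longrightarrow> 0 \<le> x (i, l)"
  shows "(\<Sum>j | j \<in> E \<and> {j} \<in> \<I>. item_gain j (chosen x) x) \<le>
    (\<Sum>i\<in>N. opt_weight \<I> x (N - {i}) E) - (real (card N) - 1) * opt_weight \<I> x N E"
proof -
  let ?A = "chosen x"
  have full: "?A \<in> full_allocs \<I> N E"
    unfolding chosen_def by (intro lex_best_in finite_full_allocs full_allocs_ne inj_full_rank)
  then have A: "?A \<in> indep_allocs \<I> N E" by (simp add: full_allocs_def)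
  obtain B where B: "B \<in> full_allocs \<I> N E" "alloc_weight x N B = opt_weight \<I> x N E"
    using full_alloc_optimal[OF mat N many, of x] x by blast
  have "alloc_weight x N B \<le> alloc_weight x N ?A"
    unfolding chosen_def by (rule lex_best_max[OF finite_full_allocs full_allocs_ne inj_full_rank B(1)])
  with B(2) opt_weight_ge[OF indep_system N A, of x] have opt: "alloc_weight x N ?A = opt_weight \<I> x N E" by simp
  have "(\<Sum>j | j \<in> E \<and> {j} \<in> \<I>. item_gain j ?A x) =
      (\<Sum>i\<in>N. \<Sum>j | j \<in> E \<and> {j} \<in> \<I>. if j \<in> ?A i then gain E \<I> x (N - {i}) (?A i) j else 0)"
    unfolding item_gain_def by (rule sum.swap)
  also have "\<dots> = (\<Sum>i\<in>N. \<Sum>j\<in>?A i. gain E \<I> x (N - {i}) (?A i) j)"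
  proof (rule sum.cong[OF refl])
    fix i assume i: "i \<in> N"
    then have "?A i \<in> \<I>" using A by (auto simp: indep_allocs_def PiE_iff)
    then have "?A i \<subseteq> E" "{l} \<in> \<I>" if "l \<in> ?A i" for l
      using mat that by (auto simp: matroid_def)
    then have "?A i \<subseteq> {j. j \<in> E \<and> {j} \<in> \<I>}" by blast
    then have "{j \<in> {j. j \<in> E \<and> {j} \<in> \<I>}. j \<in> ?A i} = ?A i" by auto
    moreover have "finite {j. j \<in> E \<and> {j} \<in> \<I>}" using indep_system by auto
    ultimately show "(\<Sum>j | j \<in> E \<and> {j} \<in> \<I>. if j \<in> ?A i then gain E \<I> x (N - {i}) (?A i) j else 0) =
      (\<Sum>j\<in>?A i. gain E \<I> x (N - {i}) (?A i) j)"
      by (simp add: sum.inter_filter[symmetric])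
  qed
  also have "\<dots> \<le> (\<Sum>i\<in>N. opt_weight \<I> x (N - {i}) E) - (real (card N) - 1) * opt_weight \<I> x N E"
    by (rule sum_gain_le_payments[OF mat N A opt])
  finally show ?thesis .
qed

text \<open>
  Once the values for all items but \<open>j\<close> are fixed, the chosen allocation is determined by the
  bidder who gets \<open>j\<close>, and so are the competitors that bound the price of \<open>j\<close> from below.
\<close>

lemma nn_integral_item_gain:
  assumes j: "j \<in> E" "{j} \<in> \<I>" and K0: "K0 \<subseteq> N" "card K0 = Suc k"
    and k: "k + disjoint_spanning_number E \<I> < card N"
  shows "(\<integral>\<^sup>+x. ennreal (runner_up K0 (\<lambda>i. x (i, j))) \<partial>profiles) \<le>
    (\<integral>\<^sup>+x. ennreal (item_gain j (chosen x) x) \<partial>profiles)"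
proof -
  interpret P: product_sigma_finite "\<lambda>p :: nat \<times> nat. D (snd p)"
    using D(1) by (simp add: product_sigma_finite_def prob_space_imp_sigma_finite)
  define I J where "I = N \<times> (E - {j})" and "J = N \<times> {j}"
  have IJ: "I \<inter> J = {}" "finite I" "finite J" "N \<times> E = I \<union> J"
    using N indep_system j by (auto simp: I_def J_def)
  note fold = P.product_nn_integral_fold[OF IJ(1-3), folded IJ(4)]
  have K0': "finite K0" "K0 \<noteq> {}" using K0 N by (auto intro: finite_subset)
  have m1: "(\<lambda>x. ennreal (runner_up K0 (\<lambda>i. x (i, j)))) \<in> borel_measurable profiles"
    using K0 K0' j by (intro measurable_compose[OF _ measurable_ennreal] borel_measurable_runner_up
        measurable_profile_component) auto
  have m2: "(\<lambda>x. ennreal (item_gain j (chosen x) x)) \<in> borel_measurable profiles"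
    by (intro measurable_compose[OF _ measurable_ennreal] measurable_item_gain)
  have PJ: "PiM J (\<lambda>p. D (snd p)) = PiM J (\<lambda>_. D j)"
    by (intro PiM_cong) (auto simp: J_def)
  show ?thesis
    unfolding fold[OF m1] fold[OF m2] PJ
  proof (rule nn_integral_mono)
    fix y
    define x where "x u = merge I J (y, u)" for u :: "nat \<times> nat \<Rightarrow> real"
    \<comment> \<open>Here \<open>y\<close> holds the values for the other items, \<open>u\<close>
      those for \<open>j\<close>, and \<open>x u\<close> joins them. In \<open>z\<close> the item
      \<open>j\<close> is worthless, so \<open>z\<close> carries exactly the information that is
      fixed.\<close>
    define z where "z = x (\<lambda>_. 0)"
    have xj: "x u (i, j) = u (i, j)" if "i \<in> N" for u i
      using that by (simp add: x_def merge_def I_def J_def)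
    have xz: "x u p = z p" if "snd p \<noteq> j" for u p
      using that by (cases p) (simp add: z_def x_def merge_def I_def J_def)
    let ?F = "\<lambda>i. {A \<in> full_allocs \<I> N E. j \<in> A i}"
    have F: "finite (?F i)" "inj_on full_rank (?F i)" for i
      using finite_full_allocs inj_full_rank by (auto intro: inj_on_subset)
    have Fne: "?F i \<noteq> {}" if "i \<in> N" for i using full_alloc_with[OF that j] by auto
    \<comment> \<open>All allocations that give \<open>j\<close> to \<open>i\<close> gain the same
      amount \<open>u (i, j)\<close>, so their ranking among themselves does not depend on
      \<open>u\<close>.\<close>
    have weight: "alloc_weight (x u) N A = alloc_weight z N A + u (i, j)" if i: "i \<in> N" and A: "A \<in> ?F i" for u i A
    proof -
      have iA: "A \<in> indep_allocs \<I> N E" using A by (simp add: full_allocs_def)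
      have fin: "finite (A i)" using finite_indep[OF indep_system N] iA i by (auto simp: indep_allocs_def PiE_iff)
      have "j \<notin> A c" if "c \<in> N" "c \<noteq> i" for c
        using iA that A i by (auto simp: indep_allocs_def disjoint_family_on_def)
      then have "(\<Sum>l\<in>A c. x u (c, l)) = (\<Sum>l\<in>A c. z (c, l))" if "c \<in> N - {i}" for c
        using that xz by (intro sum.cong refl xz) auto
      moreover have "(\<Sum>l\<in>A i. x u (i, l)) = (\<Sum>l\<in>A i. z (i, l)) + u (i, j)"
      proof -
        have "(\<Sum>l\<in>A i - {j}. x u (i, l)) = (\<Sum>l\<in>A i - {j}. z (i, l))"
          by (intro sum.cong refl xz) auto
        moreover have "z (i, j) = 0" unfolding z_def using xj[OF i] by simp
        ultimately show ?thesis using A fin xj[OF i] by (simp add: sum.remove[of "A i" j])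
      qed
      ultimately show ?thesis
        unfolding alloc_weight_def using N i by (simp add: sum.remove[of N i])
    qed
    define B where "B i = lex_best (?F i) (alloc_weight z N) full_rank" for i
    have B: "B i \<in> ?F i" if "i \<in> N" for i
      unfolding B_def by (rule lex_best_in[OF F(1) Fne[OF that] F(2)])
    then have Bj: "j \<in> B i i" if "i \<in> N" for i using that by auto
    \<comment> \<open>The handicap of bidder \<open>i\<close> is the weight, with \<open>j\<close>
      counted as worthless, of the best full allocation that gives her \<open>j\<close>. Ties are
      inherited from the ranks of these allocations.\<close>
    define g where "g p = alloc_weight z N (B (fst p))" for p :: "nat \<times> nat"
    define r where "r p = full_rank (B (fst p))" for p :: "nat \<times> nat"
    have r: "inj_on r J"
    proof (rule inj_onI)
      fix p p' assume p: "p \<in> J" "p' \<in> J" "r p = r p'"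
      then obtain i i' where i: "p = (i, j)" "p' = (i', j)" "i \<in> N" "i' \<in> N" by (auto simp: J_def)
      have "B i = B i'"
        using p i B inj_full_rank unfolding r_def inj_on_def by auto
      then have "j \<in> B i i" "j \<in> B i i'" using Bj[OF i(3)] Bj[OF i(4)] by simp_all
      moreover have "disjoint_family_on (B i) N" using B[OF i(3)] by (auto simp: full_allocs_def indep_allocs_def)
      ultimately have "i = i'" using i by (auto simp: disjoint_family_on_def)
      then show "p = p'" using i by simp
    qed
    \<comment> \<open>A rival allocation gives \<open>j\<close> to some \<open>c\<close>. It loses
      to \<open>B c\<close>, which has the same winner of \<open>j\<close>, and \<open>B c\<close>
      loses to \<open>B i\<close> because \<open>i\<close> wins the contest with handicaps.\<close>
    have chosen: "chosen (x u) = B i" if i: "i \<in> N" and w: "u \<in> wins J g r (i, j)" for u i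
      unfolding chosen_def
    proof (rule lex_best_eqI[OF finite_full_allocs inj_full_rank])
      show "B i \<in> full_allocs \<I> N E" using B[OF i] by auto
      fix A assume A: "A \<in> full_allocs \<I> N E" "A \<noteq> B i"
      then obtain c where c: "c \<in> N" "j \<in> A c" using j by (auto simp: full_allocs_def)
      then have Ac: "A \<in> ?F c" using A by auto
      have sub: "lex_better (alloc_weight (x u) N) full_rank (B c) A" if "A \<noteq> B c"
      proof -
        have "lex_better (alloc_weight z N) full_rank (B c) A"
          unfolding B_def using that Ac by (intro lex_best_better F Fne c(1)) (auto simp: B_def)
        then show ?thesis
          using weight[OF c(1) Ac, of u] weight[OF c(1) B[OF c(1)], of u] by (simp add: lex_better_def)
      qed
      show "lex_better (alloc_weight (x u) N) full_rank (B i) A"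
      proof (cases "c = i")
        case False
        have "(c, j) \<in> J - {(i, j)}" using c False by (auto simp: J_def)
        then have "lex_better (\<lambda>c. u c + g c) r (i, j) (c, j)" using w by (auto simp: wins_def)
        then have "lex_better (alloc_weight (x u) N) full_rank (B i) (B c)"
          using weight[OF c(1) B[OF c(1)], of u] weight[OF i B[OF i], of u]
          by (simp add: lex_better_def g_def r_def add.commute)
        then show ?thesis using sub lex_better_trans by (cases "A = B c") auto
      qed (use sub A in auto)
    qed
    \<comment> \<open>These are the items available to the others just before \<open>j\<close> is
      returned. Since \<open>j\<close> is not among them, the optimal allocation \<open>C i\<close>
      below can be chosen once for all \<open>u\<close>.\<close>
    define S where "S i = (E - B i i) \<union> {l \<in> B i i. l < j}" for i
    have S: "j \<notin> S i" "(E - B i i) \<union> {l \<in> B i i. l \<le> j} = insert j (S i)" if "i \<in> N" for i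
      using Bj[OF that] by (auto simp: S_def)
    have "\<exists>C\<in>indep_allocs \<I> (N - {i}) (S i). alloc_weight z (N - {i}) C = opt_weight \<I> z (N - {i}) (S i)" for i
      using opt_weight_attained[OF indep_system, of "N - {i}"] N by simp
    then obtain C where C: "\<And>i. C i \<in> indep_allocs \<I> (N - {i}) (S i)"
      "\<And>i. alloc_weight z (N - {i}) (C i) = opt_weight \<I> z (N - {i}) (S i)" by metis
    have same: "alloc_weight (x u) (N - {i}) A = alloc_weight z (N - {i}) A"
      if "i \<in> N" "A \<in> indep_allocs \<I> (N - {i}) (S i)" for u i A
    proof (rule alloc_weight_cong)
      fix c l assume "c \<in> N - {i}" "l \<in> A c"
      then have "l \<noteq> j" using that S(1)[OF that(1)] by (auto simp: indep_allocs_def)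
      then show "x u (c, l) = z (c, l)" by (intro xz) simp
    qed
    have Copt: "alloc_weight (x u) (N - {i}) (C i) = opt_weight \<I> (x u) (N - {i}) (S i)" if "i \<in> N" for u i
    proof -
      have "opt_weight \<I> (x u) (N - {i}) (S i) = opt_weight \<I> z (N - {i}) (S i)"
        unfolding opt_weight_def using same[OF that] by (intro arg_cong[where f=Max] image_cong) auto
      then show ?thesis using same[OF that C(1)] C(2) by simp
    qed
    define V where "V i = {c \<in> N - {i}. insert j (C i c) \<in> \<I>}" for i
    define U where "U p = V (fst p) \<times> {j}" for p :: "nat \<times> nat"
    \<comment> \<open>Of the at least \<open>k + \<rho>\<close> bidders other than \<open>i\<close>,
      at most \<rho> hold a bundle in \<open>C i\<close> that spans \<open>j\<close>.\<close>
    have cardV: "k \<le> card (V i)" if i: "i \<in> N" for i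
    proof -
      define W where "W = {c \<in> N - {i}. insert j (C i c) \<notin> \<I>}"
      have "card W \<le> disjoint_spanning_number E \<I>" unfolding W_def
        using N j S(1)[OF i] C(1)[of i] by (intro card_spanning_le[OF mat C(1)]) (auto simp: indep_allocs_def)
      moreover have "card (V i \<union> W) = card (V i) + card W"
        using N by (intro card_Un_disjoint) (auto simp: V_def W_def)
      moreover have "V i \<union> W = N - {i}" by (auto simp: V_def W_def)
      ultimately show ?thesis using k i N by (simp add: card_Diff_singleton)
    qed
    have price: "ennreal (peak (U p) u) \<le> ennreal (item_gain j (chosen (x u)) (x u))"
      if p: "p \<in> J" and w: "u \<in> wins J g r p" for p u
    proof -
      obtain i where i: "p = (i, j)" "i \<in> N" using p by (auto simp: J_def)
      have ch: "chosen (x u) = B i" using chosen[OF i(2)] w i by simp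
      have "peak (U p) u = peak (V i) (\<lambda>c. x u (c, j))"
      proof -
        have "peak (V i) (\<lambda>c. x u (c, j)) = peak (V i) (\<lambda>c. u (c, j))"
          by (intro peak_cong xj) (auto simp: V_def)
        also have "\<dots> = peak ((\<lambda>c. (c, j)) ` V i) u" by (rule peak_reindex)
        also have "(\<lambda>c. (c, j)) ` V i = U p" by (auto simp: U_def i)
        finally show ?thesis by simp
      qed
      also have "\<dots> \<le> opt_weight \<I> (x u) (N - {i}) (insert j (S i)) - opt_weight \<I> (x u) (N - {i}) (S i)"
        unfolding V_def using N by (intro peak_le_marginal[OF indep_system _ C(1) Copt[OF i(2)] S(1)[OF i(2)]]) auto
      also have "\<dots> = gain E \<I> (x u) (N - {i}) (B i i) j"
        unfolding gain_def S(2)[OF i(2)] by (simp add: S_def)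
      also have "\<dots> \<le> item_gain j (B i) (x u)"
      proof -
        have "(if j \<in> B i i then gain E \<I> (x u) (N - {i}) (B i i) j else 0) \<le> item_gain j (B i) (x u)"
          unfolding item_gain_def using N i(2) gain_nonneg[OF indep_system finite_Diff[OF N]]
          by (intro member_le_sum[of i N "\<lambda>i'. if j \<in> B i i' then gain E \<I> (x u) (N - {i'}) (B i i') j else 0"]) auto
        then show ?thesis using Bj[OF i(2)] by simp
      qed
      finally show ?thesis using ch by (simp add: ennreal_leI)
    qed
    have "(\<integral>\<^sup>+u. ennreal (runner_up K0 (\<lambda>i. x u (i, j))) \<partial>PiM J (\<lambda>_. D j)) =
        (\<integral>\<^sup>+u. ennreal (runner_up (K0 \<times> {j}) u) \<partial>PiM J (\<lambda>_. D j))"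
    proof (rule nn_integral_cong)
      fix u
      have "runner_up K0 (\<lambda>i. x u (i, j)) = runner_up K0 (\<lambda>i. u (i, j))"
        using K0 by (intro runner_up_cong xj) auto
      also have "\<dots> = runner_up ((\<lambda>i. (i, j)) ` K0) u"
        by (intro runner_up_reindex) (auto simp: inj_on_def)
      also have "(\<lambda>i. (i, j)) ` K0 = K0 \<times> {j}" by auto
      finally show "ennreal (runner_up K0 (\<lambda>i. x u (i, j))) = ennreal (runner_up (K0 \<times> {j}) u)" by simp
    qed
    also have "\<dots> \<le> (\<integral>\<^sup>+u. ennreal (item_gain j (chosen (x u)) (x u)) \<partial>PiM J (\<lambda>_. D j))"
    proof (rule nn_integral_runner_up_le_winner_price[where U=U and k=k, OF D IJ(3) r _ _ _ _ price])
      fix p assume "p \<in> J"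
      then obtain i where i: "p = (i, j)" "i \<in> N" by (auto simp: J_def)
      show "U p \<subseteq> J - {p}" by (auto simp: U_def V_def J_def i)
      show "k \<le> card (U p)" using cardV i by (simp add: U_def card_cartesian_product)
    qed (use K0 in \<open>auto simp: J_def card_cartesian_product\<close>)
    finally show "(\<integral>\<^sup>+u. ennreal (runner_up K0 (\<lambda>i. merge I J (y, u) (i, j))) \<partial>PiM J (\<lambda>_. D j)) \<le>
      (\<integral>\<^sup>+u. ennreal (item_gain j (chosen (merge I J (y, u))) (merge I J (y, u))) \<partial>PiM J (\<lambda>_. D j))"
      unfolding x_def .
  qed
qed

end

text \<open>\<open>K0\<close> plays the additive market with \<open>k + 1\<close> bidders, and
  \<open>N\<close>, with at least \<open>k + 1 + \<rho>\<close> bidders, the constrained one. Loops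
  are left out on the additive side, where they would earn something.\<close>

lemma nn_integral_runner_up_le_payments:
  assumes K0: "K0 \<subseteq> N" "card K0 = Suc k" and k: "k + disjoint_spanning_number E \<I> < card N"
    and nonneg: "\<And>l. l \<in> E \<Longrightarrow> AE v in D l. 0 \<le> v"
  shows "(\<Sum>j | j \<in> E \<and> {j} \<in> \<I>. \<integral>\<^sup>+x. ennreal (runner_up K0 (\<lambda>i. x (i, j))) \<partial>profiles) \<le>
    (\<integral>\<^sup>+x. ennreal ((\<Sum>i\<in>N. opt_weight \<I> x (N - {i}) E) - (real (card N) - 1) * opt_weight \<I> x N E) \<partial>profiles)"
proof -
  have many: "disjoint_spanning_number E \<I> < card N" using k by simp
  have "(\<Sum>j | j \<in> E \<and> {j} \<in> \<I>. \<integral>\<^sup>+x. ennreal (runner_up K0 (\<lambda>i. x (i, j))) \<partial>profiles) \<le>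
      (\<Sum>j | j \<in> E \<and> {j} \<in> \<I>. \<integral>\<^sup>+x. ennreal (item_gain j (chosen x) x) \<partial>profiles)"
    by (intro sum_mono nn_integral_item_gain[OF many _ _ K0 k]) auto
  also have "\<dots> = (\<integral>\<^sup>+x. (\<Sum>j | j \<in> E \<and> {j} \<in> \<I>. ennreal (item_gain j (chosen x) x)) \<partial>profiles)"
    using measurable_item_gain[OF many] by (intro nn_integral_sum[symmetric]) simp
  also have "\<dots> \<le> (\<integral>\<^sup>+x. ennreal ((\<Sum>i\<in>N. opt_weight \<I> x (N - {i}) E) - (real (card N) - 1) * opt_weight \<I> x N E) \<partial>profiles)"
  proof (rule nn_integral_mono_AE)
    have "AE x in profiles. 0 \<le> x p" if "p \<in> N \<times> E" for p
      using that D(1) nonneg by (intro AE_PiM_component) auto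
    moreover have "finite (N \<times> E)" using N indep_system by simp
    ultimately have "AE x in profiles. \<forall>p\<in>N \<times> E. 0 \<le> x p" by (intro AE_finite_allI)
    then show "AE x in profiles. (\<Sum>j | j \<in> E \<and> {j} \<in> \<I>. ennreal (item_gain j (chosen x) x)) \<le>
        ennreal ((\<Sum>i\<in>N. opt_weight \<I> x (N - {i}) E) - (real (card N) - 1) * opt_weight \<I> x N E)"
    proof eventually_elim
      case (elim x)
      then show ?case
        using sum_item_gain_le_payments[OF many, of x] item_gain_nonneg
        by (subst sum_ennreal) (auto intro!: ennreal_leI)
    qed
  qed
  finally show ?thesis .
qed

end

subsection \<open>VCG revenue as an integral over item values\<close>

lemma prob_space_regular: "regular_distribution D \<Longrightarrow> prob_space D"
  and sets_regular: "regular_distribution D \<Longrightarrow> sets D = sets borel"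
  by (auto simp: regular_distribution_def real_distribution_def real_distribution_axioms_def)

lemma regular_nonneg:
  assumes "regular_distribution D"
  shows "AE v in D. 0 \<le> v"
proof -
  obtain f T where f: "f \<in> borel_measurable borel" "T \<subseteq> {0..}" "\<forall>x. x \<notin> T \<longrightarrow> f x = 0"
    "D = density lborel (\<lambda>x. ennreal (f x))"
    using assms by (auto simp: regular_distribution_def)
  have "(\<lambda>x. ennreal (f x)) \<in> borel_measurable lborel" using f(1) by measurable
  moreover have "0 < ennreal (f x) \<longrightarrow> 0 \<le> x" for x using f(2,3) by (cases "x \<in> T") auto
  ultimately show ?thesis unfolding f(4) by (subst AE_density) auto
qed

lemma measurable_constrained_valuation:
  assumes \<I>: "\<I> \<subseteq> Pow {..<m}" "{} \<in> \<I>"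
    and x: "\<And>l. l < m \<Longrightarrow> (\<lambda>\<omega>. x \<omega> l) \<in> borel_measurable M"
  shows "(\<lambda>\<omega>. constrained_valuation m \<I> (x \<omega>)) \<in> measurable M (valuation_space m)"
  unfolding constrained_valuation_def valuation_space_def
proof (intro measurable_restrict borel_measurable_Max borel_measurable_sum x)
  show "finite {T \<in> \<I>. T \<subseteq> S}" for S
    using \<I>(1) by (rule_tac finite_subset[of _ "Pow {..<m}"]) auto
qed (use \<I> in auto)

lemma constrained_valuation_cong:
  assumes "\<I> \<subseteq> Pow {..<m}" "\<And>T l. T \<in> \<I> \<Longrightarrow> l \<in> T \<Longrightarrow> x l = y l"
  shows "constrained_valuation m \<I> x = constrained_valuation m \<I> y"
proof -
  have "(\<lambda>T. \<Sum>j\<in>T. x j) ` {T \<in> \<I>. T \<subseteq> S} = (\<lambda>T. \<Sum>j\<in>T. y j) ` {T \<in> \<I>. T \<subseteq> S}" for S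
    using assms(2) by (intro image_cong sum.cong refl) auto
  then show ?thesis unfolding constrained_valuation_def by simp
qed

lemma measurable_max_welfare:
  assumes "finite N'" "N' \<subseteq> N"
  shows "(\<lambda>b. max_welfare m N' b) \<in> borel_measurable (PiM N (\<lambda>_. valuation_space m))"
  unfolding max_welfare_def welfare_def
proof (intro borel_measurable_Max borel_measurable_sum)
  fix A i assume A: "A \<in> allocations m N'" "i \<in> N'"
  then have "A i \<in> Pow {..<m}" by (auto simp: allocations_def PiE_iff)
  then have "(\<lambda>v. v (A i)) \<in> borel_measurable (valuation_space m)"
    unfolding valuation_space_def by (rule measurable_component_singleton)
  moreover have "(\<lambda>b. b i) \<in> measurable (PiM N (\<lambda>_. valuation_space m)) (valuation_space m)"
    using A assms by (intro measurable_component_singleton) auto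
  ultimately show "(\<lambda>b. b i (A i)) \<in> borel_measurable (PiM N (\<lambda>_. valuation_space m))"
    by (rule measurable_compose[rotated])
qed (use assms finite_allocations allocations_ne in auto)

section \<open>Product measures under push-forward and currying\<close>

lemma PiM_distr:
  assumes P: "prob_space P" and h: "h \<in> measurable P V" and N: "finite N"
  shows "PiM N (\<lambda>_. distr P V h) = distr (PiM N (\<lambda>_. P)) (PiM N (\<lambda>_. V)) (\<lambda>b. \<lambda>i\<in>N. h (b i))"
proof -
  let ?V = "distr P V h"
  have h': "h \<in> measurable P ?V" using h by simp
  have eq: "distr P ?V h = ?V" by (intro distr_cong) auto
  have "PiM N (\<lambda>_. ?V) = distr (PiM N (\<lambda>_. P)) (PiM N (\<lambda>_. ?V)) (compose N h)"
    using distr_PiM_finite_prob_space'[OF N, of "\<lambda>_. P" "\<lambda>_. ?V" h] P prob_space.prob_space_distr[OF P h] h'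
    by (simp add: eq)
  also have "\<dots> = distr (PiM N (\<lambda>_. P)) (PiM N (\<lambda>_. V)) (\<lambda>b. \<lambda>i\<in>N. h (b i))"
    by (intro distr_cong sets_PiM_cong) (auto simp: compose_def)
  finally show ?thesis .
qed

lemma measurable_map_PiM:
  assumes h: "h \<in> measurable P V"
  shows "(\<lambda>b. \<lambda>i\<in>N. h (b i)) \<in> measurable (PiM N (\<lambda>_. P)) (PiM N (\<lambda>_. V))"
  by (intro measurable_restrict measurable_compose[OF _ h] measurable_component_singleton)

lemma pair_PiM_distr:
  assumes P: "prob_space P" and h: "h \<in> measurable P V" and N: "finite N"
  shows "R \<Otimes>\<^sub>M PiM N (\<lambda>_. distr P V h) =
    distr (R \<Otimes>\<^sub>M PiM N (\<lambda>_. P)) (R \<Otimes>\<^sub>M PiM N (\<lambda>_. V)) (\<lambda>(r, b). (r, \<lambda>i\<in>N. h (b i)))"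
proof -
  have "prob_space (PiM N (\<lambda>_. distr P V h))"
    by (intro prob_space_PiM prob_space.prob_space_distr[OF P h])
  then have "sigma_finite_measure (PiM N (\<lambda>_. distr P V h))" by (rule prob_space_imp_sigma_finite)
  then show ?thesis
    using pair_measure_distr[of "\<lambda>x. x" R R, OF _ measurable_map_PiM[OF h, of N]]
    unfolding PiM_distr[OF P h N] by simp
qed

text \<open>The coordinates \<open>x (i, l)\<close> are independent. Grouping them into the blocks
  \<open>{i} \<times> E\<close> keeps independence, and every block has the law
  \<open>PiM E D\<close>.\<close>

lemma PiM_curry:
  assumes D: "\<And>j. prob_space (D j)" and ne: "N \<noteq> {}" "E \<noteq> {}"
  shows "PiM N (\<lambda>_. PiM E D) =
    distr (PiM (N \<times> E) (\<lambda>p. D (snd p))) (PiM N (\<lambda>_. PiM E D)) (\<lambda>x. \<lambda>i\<in>N. \<lambda>l\<in>E. x (i, l))"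
proof -
  let ?P = "PiM (N \<times> E) (\<lambda>p. D (snd p))"
  interpret P: prob_space ?P using D by (intro prob_space_PiM) auto
  have coord: "P.indep_vars (\<lambda>p. D (snd p)) (\<lambda>p x. x p) (N \<times> E)"
  proof (subst P.indep_vars_iff_distr_eq_PiM')
    have "distr ?P ?P (\<lambda>x. \<lambda>p\<in>N \<times> E. x p) = distr ?P ?P (\<lambda>x. x)"
      by (intro distr_cong) (auto simp: space_PiM PiE_restrict)
    also have "\<dots> = ?P" by (rule distr_id)
    also have "\<dots> = PiM (N \<times> E) (\<lambda>p. distr ?P (D (snd p)) (\<lambda>x. x p))"
      using D by (intro PiM_cong refl distr_PiM_component[symmetric]) auto
    finally show "distr ?P ?P (\<lambda>x. \<lambda>p\<in>N \<times> E. x p) = PiM (N \<times> E) (\<lambda>p. distr ?P (D (snd p)) (\<lambda>x. x p))" .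
  qed (use ne in \<open>auto intro: measurable_component_singleton\<close>)
  have "P.indep_vars (\<lambda>i. PiM ({i} \<times> E) (\<lambda>p. D (snd p))) (\<lambda>i x. restrict (\<lambda>p. x p) ({i} \<times> E)) N"
    by (rule P.indep_vars_restrict[OF coord]) (auto simp: disjoint_family_on_def)
  then have "P.indep_vars (\<lambda>_. PiM E D) (\<lambda>i x. (\<lambda>y. \<lambda>l\<in>E. y (i, l)) (restrict (\<lambda>p. x p) ({i} \<times> E))) N"
  proof (rule P.indep_vars_compose2)
    fix i
    show "(\<lambda>y. \<lambda>l\<in>E. y (i, l)) \<in> measurable (PiM ({i} \<times> E) (\<lambda>p. D (snd p))) (PiM E D)"
    proof (rule measurable_restrict)
      fix l assume "l \<in> E"
      then show "(\<lambda>y. y (i, l)) \<in> measurable (PiM ({i} \<times> E) (\<lambda>p. D (snd p))) (D l)"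
        using measurable_component_singleton[of "(i, l)" "{i} \<times> E" "\<lambda>p. D (snd p)"] by simp
    qed
  qed
  then have ind: "P.indep_vars (\<lambda>_. PiM E D) (\<lambda>i x. \<lambda>l\<in>E. x (i, l)) N"
    by (simp add: restrict_def cong: if_cong)
  have rv: "(\<lambda>x. \<lambda>l\<in>E. x (i, l)) \<in> measurable ?P (PiM E D)" if "i \<in> N" for i
  proof (rule measurable_restrict)
    fix l assume "l \<in> E"
    then show "(\<lambda>x. x (i, l)) \<in> measurable ?P (D l)"
      using that measurable_component_singleton[of "(i, l)" "N \<times> E" "\<lambda>p. D (snd p)"] by simp
  qed
  have "distr ?P (PiM N (\<lambda>_. PiM E D)) (\<lambda>x. \<lambda>i\<in>N. \<lambda>l\<in>E. x (i, l)) =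
      PiM N (\<lambda>i. distr ?P (PiM E D) (\<lambda>x. \<lambda>l\<in>E. x (i, l)))"
    using P.indep_vars_iff_distr_eq_PiM'[OF ne(1) rv] ind by simp
  also have "\<dots> = PiM N (\<lambda>_. PiM E D)"
  proof (rule PiM_cong[OF refl])
    fix i assume "i \<in> N"
    then show "distr ?P (PiM E D) (\<lambda>x. \<lambda>l\<in>E. x (i, l)) = PiM E D"
      using distr_PiM_reindex[of "N \<times> E" "\<lambda>p. D (snd p)" "\<lambda>l. (i, l)" E] D by (simp add: inj_on_def)
  qed
  finally show ?thesis by simp
qed

lemma nn_integral_snd_component:
  assumes "prob_space R" "sigma_finite_measure Q" and f: "f \<in> borel_measurable Q"
  shows "(\<integral>\<^sup>+z. f (snd z) \<partial>(R \<Otimes>\<^sub>M Q)) = integral\<^sup>N Q f"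
proof -
  interpret R: prob_space R by fact
  interpret Q: sigma_finite_measure Q by fact
  have "(\<integral>\<^sup>+z. f (snd z) \<partial>(R \<Otimes>\<^sub>M Q)) = (\<integral>\<^sup>+r. \<integral>\<^sup>+b. f (snd (r, b)) \<partial>Q \<partial>R)"
    by (intro Q.nn_integral_fst[symmetric] measurable_compose[OF measurable_snd f])
  then show ?thesis by (simp add: R.emeasure_space_1)
qed

definition payment_total :: "nat \<Rightarrow> nat set set \<Rightarrow> nat \<Rightarrow> (nat \<times> nat \<Rightarrow> real) \<Rightarrow> real" where
  "payment_total m \<I> k x = (\<Sum>i<k. opt_weight \<I> x ({..<k} - {i}) {..<m}) -
     (real k - 1) * opt_weight \<I> x {..<k} {..<m}"

text \<open>Payments are non-negative, so the extended expectation has no negative part. The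
  constant seed is integrated out, and the valuations are pulled back first to item values per
  bidder and then to one array of values.\<close>

lemma Rev_VCG:
  assumes \<I>: "\<I> \<subseteq> Pow {..<m}" "{} \<in> \<I>" and k: "k \<ge> 1" and m: "m \<ge> 1"
    and D: "\<And>j. prob_space (D j)" "\<And>j. sets (D j) = sets borel"
  shows "Rev (VCG m k) (distr (PiM {..<m} D) (valuation_space m) (constrained_valuation m \<I>)) k =
    enn2ereal (\<integral>\<^sup>+x. ennreal (payment_total m \<I> k x) \<partial>PiM ({..<k} \<times> {..<m}) (\<lambda>p. D (snd p)))"
proof -
  define V where "V = valuation_space m"
  define P where "P = PiM {..<m} D"
  define c where "c = constrained_valuation m \<I>"
  define N where "N = {..<k}"
  define f where "f b = (\<Sum>i<k. vcg_pay m k b i)" for b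
  let ?R = "PiM (N \<times> {..<m}) (\<lambda>p. D (snd p))"
  interpret P: prob_space P unfolding P_def using D by (intro prob_space_PiM) auto
  have c: "c \<in> measurable P V"
    unfolding c_def V_def
  proof (rule measurable_constrained_valuation[OF \<I>])
    fix l assume "l < m"
    then have "(\<lambda>x. x l) \<in> measurable P (D l)"
      unfolding P_def by (intro measurable_component_singleton) simp
    then show "(\<lambda>x. x l) \<in> borel_measurable P" using D(2) by (simp cong: measurable_cong_sets)
  qed
  have f: "f \<in> borel_measurable (PiM N (\<lambda>_. V))"
    unfolding f_def sum_vcg_pay V_def N_def
    by (intro borel_measurable_diff borel_measurable_sum borel_measurable_times borel_measurable_const
        measurable_max_welfare) auto
  have fP: "(\<lambda>b. ennreal (f b)) \<in> borel_measurable (PiM N (\<lambda>_. V))" using f by measurable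
  have sQ: "sets (PiM N (\<lambda>_. distr P V c)) = sets (PiM N (\<lambda>_. V))" by (intro sets_PiM_cong) auto
  have sf: "sigma_finite_measure (PiM N (\<lambda>_. distr P V c))"
    by (intro prob_space_imp_sigma_finite prob_space_PiM P.prob_space_distr[OF c])
  have fin: "finite N" by (simp add: N_def)
  have mc: "(\<lambda>b. \<lambda>i\<in>N. c (b i)) \<in> measurable (PiM N (\<lambda>_. P)) (PiM N (\<lambda>_. V))"
    by (rule measurable_map_PiM[OF c])
  define u where "u x = (\<lambda>i\<in>N. \<lambda>l\<in>{..<m}. x (i, l))" for x :: "nat \<times> nat \<Rightarrow> real"
  have curry: "PiM N (\<lambda>_. P) = distr ?R (PiM N (\<lambda>_. P)) u"
    unfolding P_def u_def[abs_def] using k m by (intro PiM_curry D) (auto simp: N_def lessThan_empty_iff)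
  have mu: "u \<in> measurable ?R (PiM N (\<lambda>_. P))"
    unfolding u_def[abs_def] P_def
  proof (intro measurable_restrict)
    fix i l assume "i \<in> N" "l \<in> {..<m}"
    then show "(\<lambda>x. x (i, l)) \<in> measurable ?R (D l)"
      using measurable_component_singleton[of "(i, l)" "N \<times> {..<m}" "\<lambda>p. D (snd p)"] by simp
  qed
  have pay: "f (\<lambda>i\<in>N. c (u x i)) = payment_total m \<I> k x" for x
  proof -
    have b: "(\<lambda>i\<in>N. c (u x i)) i = constrained_valuation m \<I> (\<lambda>l. x (i, l))" if "i \<in> N" for i
      unfolding c_def u_def using that \<I>(1) by (simp add: restrict_def) (intro constrained_valuation_cong, auto)
    have "max_welfare m N' (\<lambda>i\<in>N. c (u x i)) = opt_weight \<I> x N' {..<m}" if "N' \<subseteq> N" for N'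
      using that fin b by (intro max_welfare_constrained[OF \<I>]) (auto intro: finite_subset)
    then show ?thesis unfolding f_def sum_vcg_pay payment_total_def N_def by simp
  qed
  have "Rev (VCG m k) (distr P V c) k =
      enn2ereal (\<integral>\<^sup>+z. ennreal (f (snd z)) \<partial>(return borel (0::real) \<Otimes>\<^sub>M PiM N (\<lambda>_. distr P V c)))"
    unfolding Rev_def extended_expectation_def truthful_def VCG_def
    by (simp add: case_prod_unfold f_def N_def ennreal_neg sum_nonneg vcg_pay_nonneg zero_ennreal.rep_eq)
  also have "(\<integral>\<^sup>+z. ennreal (f (snd z)) \<partial>(return borel (0::real) \<Otimes>\<^sub>M PiM N (\<lambda>_. distr P V c))) =
      (\<integral>\<^sup>+b. ennreal (f b) \<partial>PiM N (\<lambda>_. distr P V c))"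
    using fP by (intro nn_integral_snd_component prob_space_return sf) (simp_all cong: measurable_cong_sets add: sQ)
  also have "\<dots> = (\<integral>\<^sup>+b. ennreal (f (\<lambda>i\<in>N. c (b i))) \<partial>PiM N (\<lambda>_. P))"
    unfolding PiM_distr[OF P.prob_space_axioms c fin] by (rule nn_integral_distr[OF mc]) (use fP in simp)
  also have "\<dots> = (\<integral>\<^sup>+x. ennreal (f (\<lambda>i\<in>N. c (u x i))) \<partial>?R)"
    by (subst curry, rule nn_integral_distr[OF mu]) (use measurable_compose[OF mc fP] in simp)
  also have "\<dots> = (\<integral>\<^sup>+x. ennreal (payment_total m \<I> k x) \<partial>?R)" unfolding pay ..
  finally show ?thesis unfolding P_def V_def c_def N_def .
qed

lemma payment_total_additive:
  assumes "k \<ge> 1"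
  shows "payment_total m (Pow {..<m}) k x = (\<Sum>j<m. runner_up {..<k} (\<lambda>i. x (i, j)))"
proof -
  have "payment_total m (Pow {..<m}) k x =
      (\<Sum>j<m. (\<Sum>i<k. peak ({..<k} - {i}) (\<lambda>i. x (i, j))) - (real k - 1) * peak {..<k} (\<lambda>i. x (i, j)))"
    unfolding payment_total_def
    by (simp add: opt_weight_additive sum_subtractf sum_distrib_left sum.swap[of _ "{..<k}" "{..<m}"])
  also have "\<dots> = (\<Sum>j<m. runner_up {..<k} (\<lambda>i. x (i, j)))"
    using assms by (intro sum.cong refl) (subst sum_peak_remove, auto simp: lessThan_empty_iff)
  finally show ?thesis .
qed

text \<open>The revenue of \<open>k\<close> bidders is written over a market of
  \<open>q \<ge> k\<close> bidders, of which it sees a marginal. Additive and constrained revenue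
  then become integrals over the same measure.\<close>

lemma Rev_VCG_additive:
  assumes k: "k \<ge> 1" and m: "m \<ge> 1" and kq: "k \<le> q"
    and D: "\<And>j. prob_space (D j)" "\<And>j. sets (D j) = sets borel"
  shows "Rev (VCG m k) (distr (PiM {..<m} D) (valuation_space m) (constrained_valuation m (Pow {..<m}))) k =
    enn2ereal (\<Sum>j<m. \<integral>\<^sup>+x. ennreal (runner_up {..<k} (\<lambda>i. x (i, j))) \<partial>PiM ({..<q} \<times> {..<m}) (\<lambda>p. D (snd p)))"
proof -
  let ?P = "\<lambda>q. PiM ({..<q} \<times> {..<m}) (\<lambda>p. D (snd p))"
  have K: "finite {..<k}" "{..<k} \<noteq> {}" using k by (auto simp: lessThan_empty_iff)
  have meas: "(\<lambda>x. ennreal (runner_up {..<k} (\<lambda>i. x (i, j)))) \<in> borel_measurable (?P k)" if "j < m" for j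
  proof (intro measurable_compose[OF _ measurable_ennreal] borel_measurable_runner_up K)
    fix i assume "i \<in> {..<k}"
    then show "(\<lambda>x. x (i, j)) \<in> borel_measurable (?P k)"
      using that measurable_component_singleton[of "(i, j)" "{..<k} \<times> {..<m}" "\<lambda>p. D (snd p)"]
      by (simp add: D(2) cong: measurable_cong_sets)
  qed
  have sub: "{..<k} \<times> {..<m} \<subseteq> {..<q} \<times> {..<m}" using kq by auto
  have res: "distr (?P q) (?P k) (\<lambda>x. \<lambda>p\<in>{..<k} \<times> {..<m}. x p) = ?P k"
    using sub D by (intro distr_PiM_reindex[of _ "\<lambda>p. D (snd p)" "\<lambda>p. p"]) auto
  have mres: "(\<lambda>x. \<lambda>p\<in>{..<k} \<times> {..<m}. x p) \<in> measurable (?P q) (?P k)"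
    using sub by (intro measurable_restrict measurable_component_singleton) auto
  have eq: "(\<integral>\<^sup>+x. ennreal (runner_up {..<k} (\<lambda>i. x (i, j))) \<partial>?P k) =
      (\<integral>\<^sup>+x. ennreal (runner_up {..<k} (\<lambda>i. x (i, j))) \<partial>?P q)" if j: "j < m" for j
  proof -
    have "runner_up {..<k} (\<lambda>i. (\<lambda>p\<in>{..<k} \<times> {..<m}. x p) (i, j)) = runner_up {..<k} (\<lambda>i. x (i, j))" for x
      using j by (intro runner_up_cong) auto
    then show ?thesis using nn_integral_distr[OF mres, unfolded res, OF meas[OF j]] by simp
  qed
  have "(\<integral>\<^sup>+x. ennreal (payment_total m (Pow {..<m}) k x) \<partial>?P k) =
      (\<integral>\<^sup>+x. (\<Sum>j<m. ennreal (runner_up {..<k} (\<lambda>i. x (i, j)))) \<partial>?P k)"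
    unfolding payment_total_additive[OF k] by (subst sum_ennreal) (auto intro!: runner_up_nonneg K)
  also have "\<dots> = (\<Sum>j<m. \<integral>\<^sup>+x. ennreal (runner_up {..<k} (\<lambda>i. x (i, j))) \<partial>?P k)"
    using meas by (intro nn_integral_sum) auto
  also have "\<dots> = (\<Sum>j<m. \<integral>\<^sup>+x. ennreal (runner_up {..<k} (\<lambda>i. x (i, j))) \<partial>?P q)"
    using eq by (intro sum.cong) auto
  finally show ?thesis using Rev_VCG[of "Pow {..<m}" m k D] k m D by simp
qed

subsection \<open>Constrained bidders in an additive market\<close>

definition item_values :: "valuation \<Rightarrow> nat \<Rightarrow> real" where
  "item_values w l = w {l}"

text \<open>Defined for every report, additive or not, because incentive compatibility quantifies
  over all reports in the valuation space.\<close>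

definition constrain :: "nat \<Rightarrow> nat set set \<Rightarrow> valuation \<Rightarrow> valuation" where
  "constrain m \<I> w = constrained_valuation m \<I> (item_values w)"

definition pick :: "nat set set \<Rightarrow> valuation \<Rightarrow> nat set \<Rightarrow> nat set" where
  "pick \<I> w S = lex_best {T \<in> \<I>. T \<subseteq> S} (\<lambda>T. \<Sum>l\<in>T. w {l}) (to_nat_on \<I>)"

definition constrain_bids :: "nat \<Rightarrow> nat set set \<Rightarrow> nat set \<Rightarrow> bids \<Rightarrow> bids" where
  "constrain_bids m \<I> N b = (\<lambda>i\<in>N. constrain m \<I> (b i))"

text \<open>
  Each additive bidder is allotted the best independent part of the bundle that her
  constrained counterpart would get; a lie is then worth no more to her than it would be
  to that counterpart.
\<close>

definition lifted :: "nat \<Rightarrow> nat set set \<Rightarrow> nat \<Rightarrow> mechanism \<Rightarrow> mechanism" where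
  "lifted m \<I> n M = \<lparr>seed = seed M,
     alloc = (\<lambda>r b i. pick \<I> (b i) (alloc M r (constrain_bids m \<I> {..<n} b) i)),
     pay = (\<lambda>r b. pay M r (constrain_bids m \<I> {..<n} b))\<rparr>"

definition value_ball :: "nat \<Rightarrow> valuation \<Rightarrow> real \<Rightarrow> valuation set" where
  "value_ball m v e = {w \<in> space (valuation_space m). \<forall>S\<subseteq>{..<m}. \<bar>w S - v S\<bar> < e}"

lemma measurable_value [measurable (raw)]:
  "S \<subseteq> {..<m} \<Longrightarrow> (\<lambda>v. v S) \<in> borel_measurable (valuation_space m)"
  unfolding valuation_space_def by (rule measurable_component_singleton) simp

lemma value_ball_sets: "value_ball m v e \<in> sets (valuation_space m)"
proof -
  have "value_ball m v e = {w \<in> space (valuation_space m). \<forall>S\<in>Pow {..<m}. \<bar>w S - v S\<bar> < e}"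
    by (auto simp: value_ball_def)
  also have "\<dots> \<in> sets (valuation_space m)"
    by (intro sets.sets_Collect_finite_All) measurable
  finally show ?thesis .
qed

lemma constrained_valuation_space: "constrained_valuation m \<I> x \<in> space (valuation_space m)"
  by (auto simp: constrained_valuation_def valuation_space_def space_PiM)

context
  fixes m :: nat and \<I> :: "nat set set"
  assumes \<I>: "\<I> \<subseteq> Pow {..<m}" "{} \<in> \<I>"
begin

lemma finite_indep_family: "finite \<I>"
  using \<I>(1) by (rule finite_subset) simp

lemma measurable_constrain: "constrain m \<I> \<in> measurable (valuation_space m) (valuation_space m)"
  unfolding constrain_def[abs_def] item_values_def
  by (intro measurable_constrained_valuation[OF \<I>] measurable_value) auto

lemma pick_family: "finite {T \<in> \<I>. T \<subseteq> S}" "{T \<in> \<I>. T \<subseteq> S} \<noteq> {}" "inj_on (to_nat_on \<I>) {T \<in> \<I>. T \<subseteq> S}"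
proof -
  show "finite {T \<in> \<I>. T \<subseteq> S}" "{T \<in> \<I>. T \<subseteq> S} \<noteq> {}" using finite_indep_family \<I>(2) by auto
  have "inj_on (to_nat_on \<I>) \<I>" using finite_indep_family by (intro inj_on_to_nat_on countable_finite)
  then show "inj_on (to_nat_on \<I>) {T \<in> \<I>. T \<subseteq> S}" by (rule inj_on_subset) simp
qed

lemma pick_props: "pick \<I> w S \<in> \<I>" "pick \<I> w S \<subseteq> S"
  using lex_best_in[OF pick_family, of S "\<lambda>T. \<Sum>l\<in>T. w {l}"] by (auto simp: pick_def)

lemma measurable_pick:
  "(\<lambda>w. pick \<I> w S) \<in> measurable (valuation_space m) (count_space (Pow {..<m}))"
proof (rule measurable_compose[of _ _ "count_space {T \<in> \<I>. T \<subseteq> S}" "\<lambda>T. T"])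
  show "(\<lambda>w. pick \<I> w S) \<in> measurable (valuation_space m) (count_space {T \<in> \<I>. T \<subseteq> S})"
    unfolding pick_def using \<I>(1)
    by (intro measurable_lex_best pick_family borel_measurable_sum measurable_value) auto
  show "(\<lambda>T. T) \<in> measurable (count_space {T \<in> \<I>. T \<subseteq> S}) (count_space (Pow {..<m}))"
    using \<I>(1) by auto
qed

lemma constrain_eq_pick:
  assumes S: "S \<subseteq> {..<m}"
  shows "constrain m \<I> w S = (\<Sum>l\<in>pick \<I> w S. w {l})"
proof (rule antisym)
  obtain T where T: "T \<in> \<I>" "T \<subseteq> S" "constrain m \<I> w S = (\<Sum>l\<in>T. w {l})"
    using constrained_valuation_attained[OF finite_indep_family \<I>(2) S, of "item_values w"]
    by (auto simp: constrain_def item_values_def)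
  then have "T \<in> {T \<in> \<I>. T \<subseteq> S}" by simp
  from lex_best_max[OF pick_family this, of "\<lambda>T. \<Sum>l\<in>T. w {l}"] T(3)
  show "constrain m \<I> w S \<le> (\<Sum>l\<in>pick \<I> w S. w {l})" by (simp add: pick_def)
  show "(\<Sum>l\<in>pick \<I> w S. w {l}) \<le> constrain m \<I> w S"
    using constrained_valuation_ge[OF finite_indep_family pick_props S, of "item_values w"]
    by (simp add: constrain_def item_values_def)
qed

lemma constrain_ge:
  assumes "T \<in> \<I>" "T \<subseteq> S" "S \<subseteq> {..<m}"
  shows "(\<Sum>l\<in>T. w {l}) \<le> constrain m \<I> w S"
  using constrained_valuation_ge[OF finite_indep_family assms, of "item_values w"]
  by (simp add: constrain_def item_values_def)

text \<open>The set that is best for \<open>w\<close> has at most \<open>m\<close> items, each worth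
  at most \<open>e\<close> less under \<open>v\<close>.\<close>

lemma constrain_lipschitz:
  assumes close: "\<And>l. l < m \<Longrightarrow> w {l} \<le> v {l} + e" and e: "0 \<le> e" and S: "S \<subseteq> {..<m}"
  shows "constrain m \<I> w S \<le> constrain m \<I> v S + real m * e"
proof -
  let ?T = "pick \<I> w S"
  have T: "?T \<subseteq> {..<m}" using pick_props(1) \<I>(1) by blast
  have "constrain m \<I> w S \<le> (\<Sum>l\<in>?T. v {l} + e)"
    unfolding constrain_eq_pick[OF S] using T close by (intro sum_mono) auto
  also have "\<dots> = (\<Sum>l\<in>?T. v {l}) + real (card ?T) * e" by (simp add: sum.distrib)
  also have "\<dots> \<le> constrain m \<I> v S + real m * e"
    using constrain_ge[OF pick_props S] e card_mono[OF _ T] by (intro add_mono mult_right_mono) auto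
  finally show ?thesis .
qed

text \<open>A continuous map sends the support of a measure into the support of its image. Incentive
  constraints of the constrained market hold on its support only, so they can be used just for such
  images.\<close>

lemma constrain_support:
  assumes F: "sets F = sets (valuation_space m)" and v: "v \<in> valuation_support m F"
  shows "constrain m \<I> v \<in> valuation_support m (distr F (valuation_space m) (constrain m \<I>))"
  unfolding valuation_support_def
proof (intro CollectI conjI allI impI)
  show sp: "constrain m \<I> v \<in> space (valuation_space m)"
    unfolding constrain_def by (rule constrained_valuation_space)
  fix e :: real assume e: "0 < e"
  \<comment> \<open>The Lipschitz constant is \<open>m\<close>; the \<open>+ 1\<close> makes
    \<open>m * d < e\<close> strict and allows \<open>m = 0\<close>.\<close>
  define d where "d = e / (real m + 1)"
  have d: "0 < d" "real m * d < e" using e by (auto simp: d_def field_simps)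
  have h: "constrain m \<I> \<in> measurable F (valuation_space m)"
    using measurable_constrain F by (simp cong: measurable_cong_sets)
  have sub: "value_ball m v d \<subseteq> constrain m \<I> -` value_ball m (constrain m \<I> v) e \<inter> space F"
  proof
    fix w assume w: "w \<in> value_ball m v d"
    then have sw: "w \<in> space F" using sets_eq_imp_space_eq[OF F] by (simp add: value_ball_def)
    have "\<bar>constrain m \<I> w S - constrain m \<I> v S\<bar> < e" if S: "S \<subseteq> {..<m}" for S
    proof -
      have c: "\<bar>w {l} - v {l}\<bar> < d" if "l < m" for l
        using w that by (auto simp: value_ball_def)
      have 1: "w {l} \<le> v {l} + d" if "l < m" for l using c[OF that] by linarith
      have 2: "v {l} \<le> w {l} + d" if "l < m" for l using c[OF that] by linarith
      show ?thesis
        using constrain_lipschitz[of w v d S] constrain_lipschitz[of v w d S] 1 2 S d by force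
    qed
    then show "w \<in> constrain m \<I> -` value_ball m (constrain m \<I> v) e \<inter> space F"
      using sw measurable_space[OF h sw] by (simp add: value_ball_def)
  qed
  have "0 < emeasure F (value_ball m v d)"
    using v d by (auto simp: valuation_support_def value_ball_def)
  also have "\<dots> \<le> emeasure F (constrain m \<I> -` value_ball m (constrain m \<I> v) e \<inter> space F)"
    by (intro emeasure_mono sub measurable_sets[OF h] value_ball_sets)
  also have "\<dots> = emeasure (distr F (valuation_space m) (constrain m \<I>)) (value_ball m (constrain m \<I> v) e)"
    by (rule emeasure_distr[OF h value_ball_sets, symmetric])
  finally show "0 < emeasure (distr F (valuation_space m) (constrain m \<I>))
     {w \<in> space (valuation_space m). \<forall>S\<subseteq>{..<m}. \<bar>w S - constrain m \<I> v S\<bar> < e}"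
    by (simp add: value_ball_def)
qed

lemma measurable_constrain_bids:
  "(\<lambda>(r, b). (r, constrain_bids m \<I> N b)) \<in>
    measurable (R \<Otimes>\<^sub>M PiM N (\<lambda>_. valuation_space m)) (R \<Otimes>\<^sub>M PiM N (\<lambda>_. valuation_space m))"
  unfolding constrain_bids_def case_prod_unfold
  by (intro measurable_Pair measurable_fst measurable_compose[OF measurable_snd] measurable_map_PiM[OF measurable_constrain])

lemma is_mechanism_lifted:
  assumes M: "is_mechanism m n M"
  shows "is_mechanism m n (lifted m \<I> n M)"
proof -
  let ?Q = "seed M \<Otimes>\<^sub>M PiM {..<n} (\<lambda>_. valuation_space m)"
  have alloc: "(\<lambda>z. alloc M (fst z) (snd z) i) \<in> measurable ?Q (count_space (Pow {..<m}))"
    and pay: "(\<lambda>z. pay M (fst z) (snd z) i) \<in> borel_measurable ?Q" if "i < n" for i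
    using M that by (auto simp: is_mechanism_def case_prod_unfold)
  have conv: "(\<lambda>z. (fst z, constrain_bids m \<I> {..<n} (snd z))) \<in> measurable ?Q ?Q"
    using measurable_constrain_bids[of "{..<n}" "seed M"] by (simp add: case_prod_unfold)
  have "(\<lambda>z. pick \<I> (snd z i) (alloc M (fst z) (constrain_bids m \<I> {..<n} (snd z)) i))
      \<in> measurable ?Q (count_space (Pow {..<m}))" if i: "i < n" for i
  proof (rule measurable_compose_countable'[where I = "Pow {..<m}"
        and f = "\<lambda>S z. pick \<I> (snd z i) S" and g = "\<lambda>z. alloc M (fst z) (constrain_bids m \<I> {..<n} (snd z)) i"])
    show "(\<lambda>z. alloc M (fst z) (constrain_bids m \<I> {..<n} (snd z)) i) \<in> measurable ?Q (count_space (Pow {..<m}))"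
      using measurable_compose[OF conv alloc[OF i]] by simp
    fix S
    have "(\<lambda>z. snd z i) \<in> measurable ?Q (valuation_space m)"
      using i by (intro measurable_compose[OF measurable_snd] measurable_component_singleton) auto
    then show "(\<lambda>z. pick \<I> (snd z i) S) \<in> measurable ?Q (count_space (Pow {..<m}))"
      by (rule measurable_compose[OF _ measurable_pick])
  qed (auto intro: countable_finite)
  moreover have "(\<lambda>z. pay M (fst z) (constrain_bids m \<I> {..<n} (snd z)) i) \<in> borel_measurable ?Q" if "i < n" for i
    using measurable_compose[OF conv pay[OF that]] by simp
  moreover have "disjoint_family_on (\<lambda>i. pick \<I> (b i) (alloc M r (constrain_bids m \<I> {..<n} b) i)) {..<n}"
    if b: "b \<in> space (PiM {..<n} (\<lambda>_. valuation_space m))" for r b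
  proof -
    have "constrain_bids m \<I> {..<n} b \<in> space (PiM {..<n} (\<lambda>_. valuation_space m))"
      unfolding constrain_bids_def by (rule measurable_space[OF measurable_map_PiM[OF measurable_constrain] b])
    then have dis: "disjoint_family_on (alloc M r (constrain_bids m \<I> {..<n} b)) {..<n}"
      using M by (auto simp: is_mechanism_def)
    show ?thesis
      unfolding disjoint_family_on_def
    proof (intro ballI impI)
      fix i i' assume "i \<in> {..<n}" "i' \<in> {..<n}" "i \<noteq> i'"
      then have "alloc M r (constrain_bids m \<I> {..<n} b) i \<inter> alloc M r (constrain_bids m \<I> {..<n} b) i' = {}"
        using dis by (auto simp: disjoint_family_on_def)
      then show "pick \<I> (b i) (alloc M r (constrain_bids m \<I> {..<n} b) i) \<inter>
          pick \<I> (b i') (alloc M r (constrain_bids m \<I> {..<n} b) i') = {}"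
        using pick_props(2) by blast
    qed
  qed
  ultimately show ?thesis
    using M by (simp add: is_mechanism_def lifted_def case_prod_unfold)
qed

end

text \<open>The bundle is always one of the finitely many subsets of \<open>{..<m}\<close>, so the
  value is bounded, whatever \<open>v\<close> is.\<close>

lemma integrable_value_of_alloc:
  fixes v w :: valuation
  assumes M: "is_mechanism m n M" and F: "prob_space F" "sets F = sets (valuation_space m)"
    and i: "i < n" and w: "w \<in> space (valuation_space m)"
  shows "(\<lambda>(r, b). (r, b(i := w))) \<in> measurable (truthful M F ({..<n} - {i}))
      (seed M \<Otimes>\<^sub>M PiM {..<n} (\<lambda>_. valuation_space m))"
    and "integrable (truthful M F ({..<n} - {i})) (\<lambda>(r, b). v (alloc M r (b(i := w)) i))"
    and "z \<in> space (truthful M F ({..<n} - {i})) \<Longrightarrow> alloc M (fst z) ((snd z)(i := w)) i \<subseteq> {..<m}"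
proof -
  let ?T = "truthful M F ({..<n} - {i})"
  let ?Q = "seed M \<Otimes>\<^sub>M PiM {..<n} (\<lambda>_. valuation_space m)"
  have "real_distribution (seed M)" using M by (simp add: is_mechanism_def)
  then interpret R: real_distribution "seed M" .
  interpret B: prob_space "PiM ({..<n} - {i}) (\<lambda>_. F)" using F by (intro prob_space_PiM)
  interpret T: pair_prob_space "seed M" "PiM ({..<n} - {i}) (\<lambda>_. F)" ..
  have T: "prob_space ?T" unfolding truthful_def by (rule T.prob_space_axioms)
  have upd: "(\<lambda>b. b(i := w)) \<in> measurable (PiM ({..<n} - {i}) (\<lambda>_. F)) (PiM {..<n} (\<lambda>_. valuation_space m))"
  proof -
    have "(\<lambda>b. b(i := w)) \<in> measurable (PiM ({..<n} - {i}) (\<lambda>_. valuation_space m)) (PiM (insert i ({..<n} - {i})) (\<lambda>_. valuation_space m))"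
      using w by (intro measurable_fun_upd[where J="{..<n} - {i}"]) auto
    moreover have "insert i ({..<n} - {i}) = {..<n}" using i by auto
    moreover have "sets (PiM ({..<n} - {i}) (\<lambda>_. F)) = sets (PiM ({..<n} - {i}) (\<lambda>_. valuation_space m))"
      using F(2) by (intro sets_PiM_cong) auto
    ultimately show ?thesis by (simp cong: measurable_cong_sets)
  qed
  then show U: "(\<lambda>(r, b). (r, b(i := w))) \<in> measurable ?T ?Q"
    unfolding truthful_def case_prod_unfold
    by (intro measurable_Pair measurable_fst measurable_compose[OF measurable_snd])
  have alloc: "(\<lambda>(r, b). alloc M r b i) \<in> measurable ?Q (count_space (Pow {..<m}))"
    using M i by (simp add: is_mechanism_def)
  have a: "(\<lambda>(r, b). alloc M r (b(i := w)) i) \<in> measurable ?T (count_space (Pow {..<m}))"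
    using measurable_compose[OF U alloc] by (simp add: case_prod_unfold)
  have "(\<lambda>(r, b). v (alloc M r (b(i := w)) i)) \<in> borel_measurable ?T"
    using measurable_compose[OF a, of v borel] by (simp add: case_prod_unfold)
  moreover have sub: "alloc M (fst z) ((snd z)(i := w)) i \<subseteq> {..<m}" if "z \<in> space ?T" for z
    using measurable_space[OF a that] by (simp add: case_prod_unfold)
  moreover have "\<bar>v S\<bar> \<le> Max ((\<lambda>S. \<bar>v S\<bar>) ` Pow {..<m})" if "S \<subseteq> {..<m}" for S
    using that by (intro Max_ge) auto
  ultimately show "integrable ?T (\<lambda>(r, b). v (alloc M r (b(i := w)) i))"
    using T by (intro finite_measure.integrable_const_bound[where B="Max ((\<lambda>S. \<bar>v S\<bar>) ` Pow {..<m})"])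
      (auto simp: prob_space_def case_prod_unfold)
  show "z \<in> space ?T \<Longrightarrow> alloc M (fst z) ((snd z)(i := w)) i \<subseteq> {..<m}" by (rule sub)
qed

text \<open>The mechanism \<open>lifted\<close> keeps payments and incentives. Under truth,
  \<open>pick\<close> realizes exactly the constrained value of the bundle; under a lie it yields
  some independent part of it, worth at most the constrained value. Only true valuations have to be
  additive, hence the hypothesis on the support.\<close>

lemma OPT_constrain_le:
  assumes \<I>: "\<I> \<subseteq> Pow {..<m}" "{} \<in> \<I>"
    and F: "prob_space F" "sets F = sets (valuation_space m)"
    and add: "\<And>v S. v \<in> valuation_support m F \<Longrightarrow> S \<subseteq> {..<m} \<Longrightarrow> v S = (\<Sum>l\<in>S. v {l})"
  shows "OPT m (distr F (valuation_space m) (constrain m \<I>)) n \<le> OPT m F n"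
proof -
  define V where "V = valuation_space m"
  define G where "G = distr F V (constrain m \<I>)"
  have h: "constrain m \<I> \<in> measurable F V"
    using measurable_constrain[OF \<I>] F(2) by (simp add: V_def cong: measurable_cong_sets)
  have G: "prob_space G" "sets G = sets V" unfolding G_def using prob_space.prob_space_distr[OF F(1) h] by auto
  have "OPT m G n \<le> OPT m F n"
    unfolding OPT_def
  proof (rule SUP_mono, intro bexI[of _ "lifted m \<I> n _"])
    fix M assume "M \<in> {M. is_mechanism m n M \<and> integrable_payments m n G M \<and> BIC m n G M \<and> BIR m n G M}"
    then have M: "is_mechanism m n M" "integrable_payments m n G M" "BIC m n G M" "BIR m n G M" by auto
    let ?M = "lifted m \<I> n M"
    let ?T = "\<lambda>N. truthful ?M F N"
    let ?c = "constrain_bids m \<I>"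
    have M': "is_mechanism m n ?M" by (rule is_mechanism_lifted[OF \<I> M(1)])
    have td: "truthful M G N = distr (?T N) (seed M \<Otimes>\<^sub>M PiM N (\<lambda>_. V)) (\<lambda>(r, b). (r, ?c N b))"
      and mc: "(\<lambda>(r, b). (r, ?c N b)) \<in> measurable (?T N) (seed M \<Otimes>\<^sub>M PiM N (\<lambda>_. V))" if "finite N" for N
    proof -
      show "truthful M G N = distr (?T N) (seed M \<Otimes>\<^sub>M PiM N (\<lambda>_. V)) (\<lambda>(r, b). (r, ?c N b))"
        using pair_PiM_distr[OF F(1) h that, of "seed M"]
        by (simp add: truthful_def G_def lifted_def constrain_bids_def)
      have "sets (PiM N (\<lambda>_. F)) = sets (PiM N (\<lambda>_. V))" using F(2) by (intro sets_PiM_cong) (auto simp: V_def)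
      then have "sets (?T N) = sets (seed M \<Otimes>\<^sub>M PiM N (\<lambda>_. V))"
        unfolding truthful_def by (intro sets_pair_measure_cong) (simp_all add: lifted_def)
      then show "(\<lambda>(r, b). (r, ?c N b)) \<in> measurable (?T N) (seed M \<Otimes>\<^sub>M PiM N (\<lambda>_. V))"
        using measurable_constrain_bids[OF \<I>, of N "seed M"] by (simp add: V_def cong: measurable_cong_sets)
    qed
    have upd: "?c {..<n} (b(i := w)) = (?c ({..<n} - {i}) b)(i := constrain m \<I> w)" if "i < n" for b i w
      using that by (auto simp: constrain_bids_def fun_eq_iff)
    have cs: "constrain m \<I> w \<in> space V" for w
      unfolding constrain_def V_def by (rule constrained_valuation_space)
    have pay': "pay ?M r b = pay M r (?c {..<n} b)" for r b by (simp add: lifted_def)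
    have ip: "integrable_payments m n F ?M"
      unfolding integrable_payments_def
    proof (intro conjI allI impI ballI)
      fix i assume i: "i < n"
      have "integrable (truthful M G {..<n}) (\<lambda>(r, b). pay M r b i)"
        using M(2) i by (simp add: integrable_payments_def)
      from integrable_distr[OF mc this[unfolded td[OF finite_lessThan]]]
      show "integrable (?T {..<n}) (\<lambda>(r, b). pay ?M r b i)"
        by (simp add: pay' case_prod_unfold)
      fix w assume "w \<in> space (valuation_space m)"
      have "integrable (truthful M G ({..<n} - {i})) (\<lambda>(r, b). pay M r (b(i := constrain m \<I> w)) i)"
        using M(2) i cs[of w] by (simp add: integrable_payments_def V_def)
      from integrable_distr[OF mc this[unfolded td[OF finite_Diff[OF finite_lessThan]]]]
      show "integrable (?T ({..<n} - {i})) (\<lambda>(r, b). pay ?M r (b(i := w)) i)"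
        by (simp add: pay' upd[OF i] case_prod_unfold)
    qed
    \<comment> \<open>\<open>U\<close> is the utility in the constrained market, pulled back to
      additive bids, and \<open>W\<close> below the utility in the lifted mechanism. Over the same
      sample space the two can be compared pointwise.\<close>
    define U where "U i v w z = v (alloc M (fst z) ((?c ({..<n} - {i}) (snd z))(i := constrain m \<I> w)) i) -
        pay M (fst z) ((?c ({..<n} - {i}) (snd z))(i := constrain m \<I> w)) i" for i v w z
    have U: "integrable (?T ({..<n} - {i})) (U i v w)"
        "expected_utility n G M i v (constrain m \<I> w) = integral\<^sup>L (?T ({..<n} - {i})) (U i v w)"
      if i: "i < n" for i v w
    proof -
      let ?N = "{..<n} - {i}"
      let ?H = "\<lambda>(r, b). v (alloc M r (b(i := constrain m \<I> w)) i) - pay M r (b(i := constrain m \<I> w)) i"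
      have N: "finite ?N" by simp
      have "integrable (truthful M G ?N) (\<lambda>(r, b). pay M r (b(i := constrain m \<I> w)) i)"
        using M(2) i cs[of w] by (simp add: integrable_payments_def V_def)
      moreover have "integrable (truthful M G ?N) (\<lambda>(r, b). v (alloc M r (b(i := constrain m \<I> w)) i))"
        by (rule integrable_value_of_alloc(2)[OF M(1) G(1) _ i]) (use G(2) cs in \<open>auto simp: V_def\<close>)
      ultimately have H: "integrable (truthful M G ?N) ?H"
        by (simp add: case_prod_unfold)
      have UH: "U i v w = (\<lambda>z. ?H ((\<lambda>(r, b). (r, ?c ?N b)) z))"
        by (auto simp: U_def fun_eq_iff case_prod_unfold)
      show "integrable (?T ?N) (U i v w)"
        unfolding UH by (rule integrable_distr[OF mc[OF N] H[unfolded td[OF N]]])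
      have "?H \<in> borel_measurable (seed M \<Otimes>\<^sub>M PiM ?N (\<lambda>_. V))"
        using borel_measurable_integrable[OF H] unfolding td[OF N] by simp
      then show "expected_utility n G M i v (constrain m \<I> w) = integral\<^sup>L (?T ?N) (U i v w)"
        unfolding expected_utility_def td[OF N] UH by (rule integral_distr[OF mc[OF N]])
    qed
    define W where "W i v w z = v (pick \<I> w (alloc M (fst z) ((?c ({..<n} - {i}) (snd z))(i := constrain m \<I> w)) i)) -
        pay M (fst z) ((?c ({..<n} - {i}) (snd z))(i := constrain m \<I> w)) i" for i v w z
    have W: "integrable (?T ({..<n} - {i})) (W i v w)"
        "expected_utility n F ?M i v w = integral\<^sup>L (?T ({..<n} - {i})) (W i v w)"
      if i: "i < n" and w: "w \<in> space V" for i v w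
    proof -
      have eq: "W i v w = (\<lambda>(r, b). v (alloc ?M r (b(i := w)) i) - pay ?M r (b(i := w)) i)"
        by (simp add: W_def pay' upd[OF i] fun_eq_iff) (simp add: lifted_def upd[OF i])
      show "expected_utility n F ?M i v w = integral\<^sup>L (?T ({..<n} - {i})) (W i v w)"
        unfolding expected_utility_def eq ..
      have "integrable (?T ({..<n} - {i})) (\<lambda>(r, b). v (alloc ?M r (b(i := w)) i))"
        by (rule integrable_value_of_alloc(2)[OF M' F i]) (use w in \<open>simp add: V_def\<close>)
      moreover have "integrable (?T ({..<n} - {i})) (\<lambda>(r, b). pay ?M r (b(i := w)) i)"
        using ip i w by (simp add: integrable_payments_def V_def)
      ultimately show "integrable (?T ({..<n} - {i})) (W i v w)"
        unfolding eq by (simp add: case_prod_unfold)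
    qed
    have sub: "alloc M (fst z) ((?c ({..<n} - {i}) (snd z))(i := constrain m \<I> w)) i \<subseteq> {..<m}"
      if i: "i < n" and z: "z \<in> space (?T ({..<n} - {i}))" for i w z
    proof -
      have N: "finite ({..<n} - {i})" by simp
      have "(fst z, ?c ({..<n} - {i}) (snd z)) \<in> space (truthful M G ({..<n} - {i}))"
        using measurable_space[OF mc[OF N] z] unfolding td[OF N] by (simp add: case_prod_unfold)
      from integrable_value_of_alloc(3)[OF M(1) G(1) _ i _ this, of "constrain m \<I> w"] cs[of w] G(2)
      show ?thesis by (simp add: V_def)
    qed
    have truth: "expected_utility n F ?M i v v = expected_utility n G M i (constrain m \<I> v) (constrain m \<I> v)"
      and lie: "w \<in> space V \<Longrightarrow>
        expected_utility n F ?M i v w \<le> expected_utility n G M i (constrain m \<I> v) (constrain m \<I> w)"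
      if i: "i < n" and v: "v \<in> valuation_support m F" for i v w
    proof -
      have vV: "v \<in> space V" using v by (simp add: valuation_support_def V_def)
      have vp: "v (pick \<I> w S) = (\<Sum>l\<in>pick \<I> w S. v {l})" for w S
        using pick_props(1)[OF \<I>, of w S] \<I>(1) by (intro add[OF v]) blast
      show "expected_utility n F ?M i v v = expected_utility n G M i (constrain m \<I> v) (constrain m \<I> v)"
        unfolding W(2)[OF i vV] U(2)[OF i]
      proof (rule Bochner_Integration.integral_cong[OF refl])
        fix z assume z: "z \<in> space (?T ({..<n} - {i}))"
        show "W i v v z = U i (constrain m \<I> v) v z"
          unfolding W_def U_def using constrain_eq_pick[OF \<I> sub[OF i z], of v] vp by simp
      qed
      assume w: "w \<in> space V"
      show "expected_utility n F ?M i v w \<le> expected_utility n G M i (constrain m \<I> v) (constrain m \<I> w)"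
        unfolding W(2)[OF i w] U(2)[OF i]
      proof (rule integral_mono[OF W(1)[OF i w] U(1)[OF i]])
        fix z assume z: "z \<in> space (?T ({..<n} - {i}))"
        show "W i v w z \<le> U i (constrain m \<I> v) w z"
          unfolding W_def U_def vp using constrain_ge[OF \<I> pick_props[OF \<I>] sub[OF i z], of v w w] by simp
      qed
    qed
    have supp: "constrain m \<I> v \<in> valuation_support m G" if "v \<in> valuation_support m F" for v
      unfolding G_def V_def by (rule constrain_support[OF \<I> F(2) that])
    have "BIC m n F ?M"
      unfolding BIC_def
    proof (intro allI impI ballI)
      fix i v w assume i: "i < n" and v: "v \<in> valuation_support m F" and w: "w \<in> space (valuation_space m)"
      have "expected_utility n F ?M i v w \<le> expected_utility n G M i (constrain m \<I> v) (constrain m \<I> w)"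
        using lie[OF i v] w by (simp add: V_def)
      also have "\<dots> \<le> expected_utility n G M i (constrain m \<I> v) (constrain m \<I> v)"
        using M(3) i supp[OF v] cs[of w] by (simp add: BIC_def V_def)
      finally show "expected_utility n F ?M i v w \<le> expected_utility n F ?M i v v"
        using truth[OF i v] by simp
    qed
    moreover have "BIR m n F ?M"
      using M(4) supp truth by (auto simp: BIR_def)
    ultimately show "?M \<in> {M. is_mechanism m n M \<and> integrable_payments m n F M \<and> BIC m n F M \<and> BIR m n F M}"
      using M' ip by simp
    show "Rev M G n \<le> Rev ?M F n"
    proof -
      \<comment> \<open>Both markets collect the same payments, so the revenues agree. The free
        function \<open>g\<close> covers the positive and the negative part of the extended
        expectation at once.\<close>
      let ?p = "\<lambda>z. \<Sum>i<n. pay M (fst z) (snd z) i"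
      have mp: "?p \<in> borel_measurable (seed M \<Otimes>\<^sub>M PiM {..<n} (\<lambda>_. V))"
        using M(1) by (intro borel_measurable_sum) (auto simp: is_mechanism_def case_prod_unfold V_def)
      have "(\<integral>\<^sup>+z. ennreal (g (?p z)) \<partial>truthful M G {..<n}) =
          (\<integral>\<^sup>+z. ennreal (g (?p (fst z, ?c {..<n} (snd z)))) \<partial>?T {..<n})"
        if g: "g \<in> borel_measurable borel" for g :: "real \<Rightarrow> real"
        unfolding td[OF finite_lessThan]
        by (subst nn_integral_distr[OF mc[OF finite_lessThan]])
          (use measurable_compose[OF mp g] in \<open>auto simp: case_prod_unfold\<close>)
      from this[of "\<lambda>x. x"] this[of uminus] show ?thesis
        unfolding Rev_def extended_expectation_def case_prod_unfold pay' by simp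
    qed
  qed
  then show ?thesis unfolding G_def V_def .
qed

subsection \<open>Additive markets and loops\<close>

text \<open>Free disposal drops items of negative value. Such values have probability zero under
  regular distributions, but the identity is wanted pointwise.\<close>

lemma additive_valuation:
  assumes S: "S \<subseteq> {..<m}"
  shows "constrained_valuation m (Pow {..<m}) x S = (\<Sum>l\<in>S. max (x l) 0)"
proof -
  have fin: "finite S" using S by (rule finite_subset) simp
  obtain T where T: "T \<subseteq> S" "constrained_valuation m (Pow {..<m}) x S = (\<Sum>l\<in>T. x l)"
    using constrained_valuation_attained[of "Pow {..<m}" S m x] S by auto
  have "(\<Sum>l\<in>T. x l) \<le> (\<Sum>l\<in>T. max (x l) 0)" by (intro sum_mono) auto
  also have "\<dots> \<le> (\<Sum>l\<in>S. max (x l) 0)" using fin T by (intro sum_mono2) auto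
  finally have "constrained_valuation m (Pow {..<m}) x S \<le> (\<Sum>l\<in>S. max (x l) 0)" using T by simp
  moreover have "(\<Sum>l\<in>S. max (x l) 0) = (\<Sum>l\<in>{l\<in>S. 0 \<le> x l}. x l)"
    using fin by (intro sum.mono_neutral_cong_right) auto
  moreover have "\<dots> \<le> constrained_valuation m (Pow {..<m}) x S"
    using S by (intro constrained_valuation_ge) auto
  ultimately show ?thesis by simp
qed

text \<open>The additive valuation remembers only the positive parts of the values. Nothing is lost,
  since dropping the negative items from an independent set leaves it independent.\<close>

lemma constrain_additive:
  assumes \<I>: "\<I> \<subseteq> Pow {..<m}" "{} \<in> \<I>" and down: "\<And>A B. B \<in> \<I> \<Longrightarrow> A \<subseteq> B \<Longrightarrow> A \<in> \<I>"
  shows "constrain m \<I> (constrained_valuation m (Pow {..<m}) x) = constrained_valuation m \<I> x"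
proof -
  let ?y = "\<lambda>l. max (x l) 0"
  have fI: "finite \<I>" using \<I>(1) by (rule finite_subset) simp
  have "constrain m \<I> (constrained_valuation m (Pow {..<m}) x) = constrained_valuation m \<I> ?y"
    unfolding constrain_def
  proof (rule constrained_valuation_cong[OF \<I>(1)])
    fix T l assume "T \<in> \<I>" "l \<in> T"
    then have "{l} \<subseteq> {..<m}" using \<I>(1) by blast
    then show "item_values (constrained_valuation m (Pow {..<m}) x) l = ?y l"
      by (simp add: item_values_def additive_valuation)
  qed
  also have "\<dots> = constrained_valuation m \<I> x"
  proof
    fix S
    show "constrained_valuation m \<I> ?y S = constrained_valuation m \<I> x S"
    proof (cases "S \<subseteq> {..<m}")
      case True
      obtain T where T: "T \<in> \<I>" "T \<subseteq> S" "constrained_valuation m \<I> ?y S = (\<Sum>l\<in>T. ?y l)"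
        using constrained_valuation_attained[OF fI \<I>(2) True] by blast
      obtain T' where T': "T' \<in> \<I>" "T' \<subseteq> S" "constrained_valuation m \<I> x S = (\<Sum>l\<in>T'. x l)"
        using constrained_valuation_attained[OF fI \<I>(2) True] by blast
      have "finite T" using T(1) \<I>(1) by (auto intro: finite_subset)
      then have "(\<Sum>l\<in>T. ?y l) = (\<Sum>l\<in>{l\<in>T. 0 \<le> x l}. x l)"
        by (intro sum.mono_neutral_cong_right) auto
      also have "\<dots> \<le> constrained_valuation m \<I> x S"
        using T True down[OF T(1)] by (intro constrained_valuation_ge[OF fI]) auto
      finally have "constrained_valuation m \<I> ?y S \<le> constrained_valuation m \<I> x S" using T by simp
      moreover have "(\<Sum>l\<in>T'. x l) \<le> (\<Sum>l\<in>T'. ?y l)" by (intro sum_mono) auto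
      moreover have "\<dots> \<le> constrained_valuation m \<I> ?y S"
        using T' True by (intro constrained_valuation_ge[OF fI]) auto
      ultimately show ?thesis using T' by simp
    qed (simp add: constrained_valuation_def)
  qed
  finally show ?thesis .
qed

text \<open>Additivity is a closed condition satisfied by every valuation in the image: a valuation
  violating it has a ball without additive valuations, which then has measure zero.\<close>

lemma additive_support:
  assumes v: "v \<in> valuation_support m (distr P (valuation_space m) (constrained_valuation m (Pow {..<m})))"
      (is "v \<in> valuation_support m ?F")
    and c: "constrained_valuation m (Pow {..<m}) \<in> measurable P (valuation_space m)"
    and S: "S \<subseteq> {..<m}"
  shows "v S = (\<Sum>l\<in>S. v {l})"
proof (rule ccontr)
  assume neq: "v S \<noteq> (\<Sum>l\<in>S. v {l})"
  \<comment> \<open>The gap is compared with at most \<open>m + 1\<close> errors below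
    \<open>e\<close>: one for \<open>S\<close> itself and one for each of its items.\<close>
  define e where "e = \<bar>v S - (\<Sum>l\<in>S. v {l})\<bar> / (real m + 1)"
  have e: "0 < e" using neq by (simp add: e_def)
  have "0 < emeasure ?F (value_ball m v e)"
    using v e by (auto simp: valuation_support_def value_ball_def)
  also have "emeasure ?F (value_ball m v e) =
      emeasure P (constrained_valuation m (Pow {..<m}) -` value_ball m v e \<inter> space P)"
    by (rule emeasure_distr[OF c value_ball_sets])
  finally have "constrained_valuation m (Pow {..<m}) -` value_ball m v e \<inter> space P \<noteq> {}" by auto
  then obtain x where x: "constrained_valuation m (Pow {..<m}) x \<in> value_ball m v e" by auto
  define w where "w = constrained_valuation m (Pow {..<m}) x"
  have close: "\<bar>w T - v T\<bar> < e" if "T \<subseteq> {..<m}" for T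
    using x that by (simp add: w_def value_ball_def)
  have w: "w S = (\<Sum>l\<in>S. w {l})"
    unfolding w_def additive_valuation[OF S] using S by (intro sum.cong) (auto simp: additive_valuation)
  have "\<bar>\<Sum>l\<in>S. w {l} - v {l}\<bar> \<le> (\<Sum>l\<in>S. \<bar>w {l} - v {l}\<bar>)" by (rule sum_abs)
  also have "\<dots> \<le> (\<Sum>l\<in>S. e)" using close S by (intro sum_mono less_imp_le) auto
  also have "\<dots> \<le> real m * e" using card_mono[OF _ S] e by simp
  finally have "\<bar>w S - (\<Sum>l\<in>S. v {l})\<bar> \<le> real m * e" unfolding w by (simp add: sum_subtractf)
  moreover have "\<bar>w S - v S\<bar> < e" by (rule close[OF S])
  ultimately have "\<bar>v S - (\<Sum>l\<in>S. v {l})\<bar> < (real m + 1) * e" by (simp add: algebra_simps)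
  also have "\<dots> = \<bar>v S - (\<Sum>l\<in>S. v {l})\<bar>" by (simp add: e_def)
  finally show False by simp
qed

section \<open>Replacing the values of loops\<close>

definition uniform_dist :: "real \<Rightarrow> real measure" where
  "uniform_dist e = density lborel (\<lambda>x. ennreal (if x \<in> {0..e} then 1 / e else 0))"

lemma emeasure_uniform_dist:
  assumes e: "0 < e" and A: "A \<in> sets borel"
  shows "emeasure (uniform_dist e) A = ennreal (1 / e) * emeasure lborel ({0..e} \<inter> A)"
proof -
  have "emeasure (uniform_dist e) A = (\<integral>\<^sup>+x. ennreal (if x \<in> {0..e} then 1 / e else 0) * indicator A x \<partial>lborel)"
    unfolding uniform_dist_def using A by (intro emeasure_density) auto
  also have "\<dots> = (\<integral>\<^sup>+x. ennreal (1 / e) * indicator ({0..e} \<inter> A) x \<partial>lborel)"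
    by (intro nn_integral_cong) (auto simp: indicator_def)
  finally show ?thesis using A by (simp add: nn_integral_cmult)
qed

lemma AE_uniform_dist: "0 < e \<Longrightarrow> AE x in uniform_dist e. x \<le> e"
  unfolding uniform_dist_def by (subst AE_density) (auto simp: ennreal_zero_less_divide)

lemma regular_uniform_dist:
  assumes e: "0 < e"
  shows "regular_distribution (uniform_dist e)"
  unfolding regular_distribution_def
proof (intro conjI exI)
  let ?f = "\<lambda>x. if x \<in> {0..e} then 1 / e else 0"
  have "emeasure (uniform_dist e) (space (uniform_dist e)) = 1"
    using emeasure_uniform_dist[OF e, of UNIV] e
    by (simp add: uniform_dist_def ennreal_mult[symmetric] flip: ennreal_1)
  then have prob: "prob_space (uniform_dist e)" by (rule prob_spaceI)
  then show "real_distribution (uniform_dist e)"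
    by (simp add: real_distribution_def real_distribution_axioms_def uniform_dist_def)
  show "?f \<in> borel_measurable borel" by measurable
  show "is_interval {0..e}" by (rule is_interval_cc)
  show "{0..e} \<subseteq> {0..}" by auto
  show "\<forall>x\<in>{0..e}. 0 < ?f x" using e by auto
  show "\<forall>x. x \<notin> {0..e} \<longrightarrow> ?f x = 0" by auto
  show "uniform_dist e = density lborel (\<lambda>x. ennreal (?f x))" by (simp add: uniform_dist_def)
  have "virtual_value (uniform_dist e) ?f x = 2 * x - e" if x: "x \<in> {0..e}" for x
  proof -
    have "{0..e} \<inter> {..x} = {0..x}" using x by auto
    then have "emeasure (uniform_dist e) {..x} = ennreal (x / e)"
      using emeasure_uniform_dist[OF e, of "{..x}"] x e by (simp add: ennreal_mult[symmetric])
    then have "cdf (uniform_dist e) x = x / e" using x e by (simp add: cdf_def measure_def)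
    then show ?thesis using x e by (simp add: virtual_value_def field_simps)
  qed
  then show "mono_on {0..e} (virtual_value (uniform_dist e) ?f)" by (auto simp: mono_on_def)
qed

text \<open>By downward closure no independent set contains a loop, so the valuation is a function
  of the values in \<open>L\<close> alone, whose joint law is the same on both sides.\<close>

lemma distr_constrained_valuation_cong:
  assumes \<I>: "\<I> \<subseteq> Pow {..<m}" "{} \<in> \<I>" and down: "\<And>A B. B \<in> \<I> \<Longrightarrow> A \<subseteq> B \<Longrightarrow> A \<in> \<I>"
    and D: "\<And>j. prob_space (D j)" "\<And>j. sets (D j) = sets borel"
    and D': "\<And>j. prob_space (D' j)" "\<And>j. sets (D' j) = sets borel"
    and eq: "\<And>j. {j} \<in> \<I> \<Longrightarrow> D j = D' j"
  shows "distr (PiM {..<m} D) (valuation_space m) (constrained_valuation m \<I>) =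
    distr (PiM {..<m} D') (valuation_space m) (constrained_valuation m \<I>)"
proof -
  define L where "L = {j. j < m \<and> {j} \<in> \<I>}"
  have red: "distr (PiM {..<m} D) (valuation_space m) (constrained_valuation m \<I>) =
      distr (PiM L D) (valuation_space m) (\<lambda>x. constrained_valuation m \<I> (restrict x L))"
    if D: "\<And>j. prob_space (D j)" "\<And>j. sets (D j) = sets borel" for D :: "nat \<Rightarrow> real measure"
  proof -
    have res: "distr (PiM {..<m} D) (PiM L D) (\<lambda>x. \<lambda>l\<in>L. x l) = PiM L D"
      using D by (intro distr_PiM_reindex[of _ D "\<lambda>l. l"]) (auto simp: L_def)
    have mres: "(\<lambda>x. \<lambda>l\<in>L. x l) \<in> measurable (PiM {..<m} D) (PiM L D)"
      by (intro measurable_restrict measurable_component_singleton) (auto simp: L_def)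
    have mc: "(\<lambda>x. constrained_valuation m \<I> (restrict x L)) \<in> measurable (PiM L D) (valuation_space m)"
    proof (rule measurable_constrained_valuation[OF \<I>])
      fix l
      show "(\<lambda>x. restrict x L l) \<in> borel_measurable (PiM L D)"
      proof (cases "l \<in> L")
        case True
        then have "(\<lambda>x. x l) \<in> measurable (PiM L D) (D l)" by (rule measurable_component_singleton)
        then show ?thesis using True D(2) by (simp cong: measurable_cong_sets)
      qed simp
    qed
    have "constrained_valuation m \<I> (restrict (\<lambda>l\<in>L. x l) L) = constrained_valuation m \<I> x" for x
    proof (rule constrained_valuation_cong[OF \<I>(1)])
      fix T l assume "T \<in> \<I>" "l \<in> T"
      then have "l \<in> L" using \<I>(1) down[of T "{l}"] by (auto simp: L_def)
      then show "restrict (\<lambda>l\<in>L. x l) L l = x l" by simp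
    qed
    then show ?thesis
      using distr_distr[OF mc mres] unfolding res by (simp add: comp_def)
  qed
  have "PiM L D = PiM L D'" using eq by (intro PiM_cong) (auto simp: L_def)
  then show ?thesis unfolding red[OF D] red[OF D'] by simp
qed

lemma measurable_constrained_valuation_PiM:
  assumes "\<I> \<subseteq> Pow {..<m}" "{} \<in> \<I>" and D: "\<And>j. sets (D j) = sets borel"
  shows "constrained_valuation m \<I> \<in> measurable (PiM {..<m} D) (valuation_space m)"
proof (rule measurable_constrained_valuation[OF assms(1,2)])
  fix l assume "l < m"
  then have "(\<lambda>x. x l) \<in> measurable (PiM {..<m} D) (D l)"
    by (intro measurable_component_singleton) simp
  then show "(\<lambda>x. x l) \<in> borel_measurable (PiM {..<m} D)" using D by (simp cong: measurable_cong_sets)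
qed

text \<open>
  Loops of the matroid earn nothing in the constrained market, whereas they are sold in the
  additive one. As they do not influence the constrained valuations, their values may be
  replaced by uniform ones of size at most \<open>e\<close>.
\<close>

lemma OPT_le_Rev_VCG_plus:
  assumes n: "n \<ge> 1" and m: "m \<ge> 1" and mat: "matroid {..<m} \<I>"
    and D: "\<And>j. regular_distribution (D j)"
    and c: "\<And>F. F \<in> additive_valuations m \<Longrightarrow> OPT m F n \<le> Rev (VCG m (n + c)) F (n + c)"
    and q: "q = n + (c + disjoint_spanning_number {..<m} \<I>)" and e: "0 < e"
  shows "OPT m (distr (PiM {..<m} D) (valuation_space m) (constrained_valuation m \<I>)) n \<le>
    Rev (VCG m q) (distr (PiM {..<m} D) (valuation_space m) (constrained_valuation m \<I>)) q + ereal (real m * e)"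
proof -
  have \<I>: "\<I> \<subseteq> Pow {..<m}" "{} \<in> \<I>" and down: "\<And>A B. B \<in> \<I> \<Longrightarrow> A \<subseteq> B \<Longrightarrow> A \<in> \<I>"
    using mat by (auto simp: matroid_def)
  define D' where "D' j = (if {j} \<in> \<I> then D j else uniform_dist e)" for j
  have reg: "regular_distribution (D' j)" for j
    using D regular_uniform_dist[OF e] by (simp add: D'_def)
  have p: "prob_space (D j)" "sets (D j) = sets borel" "prob_space (D' j)" "sets (D' j) = sets borel" for j
    using D[of j] reg[of j] prob_space_regular sets_regular by auto
  let ?V = "valuation_space m"
  define G where "G = distr (PiM {..<m} D) ?V (constrained_valuation m \<I>)"
  define F where "F = distr (PiM {..<m} D') ?V (constrained_valuation m (Pow {..<m}))"
  have G: "G = distr (PiM {..<m} D') ?V (constrained_valuation m \<I>)"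
    unfolding G_def by (rule distr_constrained_valuation_cong[OF \<I> down p]) (auto simp: D'_def)
  have mP: "constrained_valuation m (Pow {..<m}) \<in> measurable (PiM {..<m} D') ?V"
    by (rule measurable_constrained_valuation_PiM) (use p in auto)
  have F: "prob_space F" "sets F = sets ?V"
    unfolding F_def using p(3) mP by (auto intro!: prob_space.prob_space_distr prob_space_PiM)
  have FG: "distr F ?V (constrain m \<I>) = G"
    unfolding F_def G using distr_distr[OF measurable_constrain[OF \<I>] mP]
    by (simp add: comp_def constrain_additive[OF \<I> down])
  define k where "k = n + c"
  have k: "k \<ge> 1" "k \<le> q" using n by (auto simp: k_def q)
  have q1: "q \<ge> 1" using k by simp
  define R where "R = PiM ({..<q} \<times> {..<m}) (\<lambda>p. D' (snd p))"
  interpret R: prob_space R unfolding R_def using p(3) by (intro prob_space_PiM) auto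
  define I where "I j = (\<integral>\<^sup>+x. ennreal (runner_up {..<k} (\<lambda>i. x (i, j))) \<partial>R)" for j
  have loop: "I j \<le> ennreal e" if j: "j < m" "{j} \<notin> \<I>" for j
  proof -
    have "AE v in D' (snd (i, j)). v \<le> e" for i :: nat
      using j AE_uniform_dist[OF e] by (simp only: snd_conv D'_def if_False)
    then have "AE x in R. x (i, j) \<le> e" if "i < q" for i
      unfolding R_def using that j p(3) by (intro AE_PiM_component) auto
    then have "AE x in R. \<forall>i\<in>{..<q}. x (i, j) \<le> e" by (intro AE_finite_allI) auto
    then have "AE x in R. ennreal (runner_up {..<k} (\<lambda>i. x (i, j))) \<le> ennreal e"
    proof eventually_elim
      case (elim x)
      have "runner_up {..<k} (\<lambda>i. x (i, j)) \<le> peak ({..<k} - {0}) (\<lambda>i. x (i, j))"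
        using k by (intro runner_up_le) auto
      also have "\<dots> \<le> e" using elim k e by (intro peak_le) auto
      finally show ?case by (rule ennreal_leI)
    qed
    then have "I j \<le> (\<integral>\<^sup>+x. ennreal e \<partial>R)" unfolding I_def by (rule nn_integral_mono_AE)
    then show ?thesis by (simp add: R.emeasure_space_1)
  qed
  have "OPT m G n \<le> OPT m F n"
    unfolding FG[symmetric] by (intro OPT_constrain_le[OF \<I> F] additive_support[OF _ mP]) (simp add: F_def)
  also have "\<dots> \<le> Rev (VCG m k) F k"
    unfolding k_def using reg by (intro c) (auto simp: F_def additive_valuations_def additive_subject_to_def)
  also have "\<dots> = enn2ereal (\<Sum>j<m. I j)"
    unfolding F_def I_def R_def by (rule Rev_VCG_additive[OF k(1) m k(2) p(3,4)])
  also have "\<dots> \<le> enn2ereal ((\<integral>\<^sup>+x. ennreal (payment_total m \<I> q x) \<partial>R) + ennreal (real m * e))"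
  proof -
    have "(\<Sum>j<m. I j) = (\<Sum>j | j \<in> {..<m} \<and> {j} \<in> \<I>. I j) + (\<Sum>j | j \<in> {..<m} \<and> {j} \<notin> \<I>. I j)"
      by (subst sum.union_disjoint[symmetric]) (auto intro!: sum.cong)
    also have "(\<Sum>j | j \<in> {..<m} \<and> {j} \<in> \<I>. I j) \<le> (\<integral>\<^sup>+x. ennreal (payment_total m \<I> q x) \<partial>R)"
    proof -
      \<comment> \<open>The bound on payments speaks of \<open>Suc k\<close> additive bidders, so it
        is applied with \<open>k - 1\<close>; then \<open>k - 1 + \<rho> < q\<close> holds because
        \<open>q = k + \<rho>\<close> and \<open>k \<ge> 1\<close>.\<close>
      have "card {..<k} = Suc (k - 1)" using k by simp
      moreover have "(k - 1) + disjoint_spanning_number {..<m} \<I> < card {..<q}" using n by (simp add: k_def q)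
      ultimately show ?thesis
        using nn_integral_runner_up_le_payments[OF mat finite_lessThan[of q] p(3,4), of "{..<k}" "k - 1"] k reg
        by (simp add: I_def R_def payment_total_def regular_nonneg)
    qed
    also have "(\<Sum>j | j \<in> {..<m} \<and> {j} \<notin> \<I>. I j) \<le> (\<Sum>j | j \<in> {..<m} \<and> {j} \<notin> \<I>. ennreal e)"
      using loop by (intro sum_mono) auto
    also have "\<dots> \<le> (\<Sum>j<m. ennreal e)" by (intro sum_mono2) auto
    also have "\<dots> = ennreal (real m * e)" using e by (simp add: ennreal_of_nat_eq_real_of_nat ennreal_mult)
    finally show ?thesis by (simp add: less_eq_ennreal.rep_eq[symmetric] add_mono)
  qed
  also have "\<dots> = Rev (VCG m q) G q + ereal (real m * e)"
    using e unfolding G Rev_VCG[OF \<I> q1 m p(3,4)] R_def by (simp add: plus_ennreal.rep_eq enn2ereal_ennreal)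
  finally show ?thesis unfolding G_def .
qed

theorem theorem5p6:
  fixes n m :: nat and \<I> :: "nat set set"
  assumes "n \<ge> 1" and "m \<ge> 1"
    and "matroid {..<m} \<I>"
  shows "competition_complexity m n (additive_subject_to m \<I>)
    \<le> competition_complexity m n (additive_valuations m) + enat (disjoint_spanning_number {..<m} \<I>)"
proof -
  define \<rho> where "\<rho> = disjoint_spanning_number {..<m} \<I>"
  define C where "C = {c. \<forall>F\<in>additive_valuations m. OPT m F n \<le> Rev (VCG m (n + c)) F (n + c)}"
  show ?thesis
  proof (cases "C = {}")
    case True
    then show ?thesis by (simp add: competition_complexity_def C_def[symmetric] top_enat_def)
  next
    case False
    \<comment> \<open>The infimum is attained because \<open>enat\<close> is well-ordered, so
      \<open>X\<close> itself is an admissible number of extra bidders.\<close>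
    then have "Inf (enat ` C) \<in> enat ` C" by (metis all_not_in_conv image_is_empty wellorder_InfI)
    then obtain c where c: "c \<in> C" "Inf (enat ` C) = enat c" by auto
    have "OPT m F n \<le> Rev (VCG m (n + (c + \<rho>))) F (n + (c + \<rho>))"
      if F: "F \<in> additive_subject_to m \<I>" for F
    proof -
      obtain D where D: "F = distr (PiM {..<m} D) (valuation_space m) (constrained_valuation m \<I>)"
          "\<forall>j. regular_distribution (D j)"
        using F unfolding additive_subject_to_def by blast
      show ?thesis
      proof (rule ereal_le_epsilon2)
        fix e :: real assume e: "0 < e"
        \<comment> \<open>Each of at most \<open>m\<close> loops costs up to the chosen bound, so
          \<open>e / m\<close> per loop leaves a total error of \<open>e\<close>.\<close>
        have "OPT m F n \<le> Rev (VCG m (n + (c + \<rho>))) F (n + (c + \<rho>)) + ereal (real m * (e / real m))"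
          unfolding D(1) using c(1) assms e
          by (intro OPT_le_Rev_VCG_plus[OF assms D(2)[rule_format], of c]) (auto simp: C_def \<rho>_def)
        then show "OPT m F n \<le> Rev (VCG m (n + (c + \<rho>))) F (n + (c + \<rho>)) + ereal e"
          using assms(2) by simp
      qed
    qed
    then have "competition_complexity m n (additive_subject_to m \<I>) \<le> enat (c + \<rho>)"
      unfolding competition_complexity_def by (intro INF_lower) auto
    also have "\<dots> = competition_complexity m n (additive_valuations m) + enat \<rho>"
      using c(2) by (simp add: competition_complexity_def C_def[symmetric])
    finally show ?thesis unfolding \<rho>_def .
  qed
qed

end
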